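(* Let $\mathfrak g$ be a finite-dimensional Lie algebra over $\mathbb K=\mathbb R$ or $\mathbb C$. If $\mathfrak g$ is $T^*$-solitary, then $\mathfrak g$ is solvable.
   Context: For a linear map $\phi\colon\mathfrak g\to\mathfrak g^*$: its transpose is ${}^t\phi\colon\mathfrak g\to\mathfrak g^*$, ${}^t\phi(X)(Y)=\phi(Y)(X)$; $\phi$ is symmetric if $\phi={}^t\phi$; $\phi$ is ad-invariant if $\phi([X,Y])(Z)=-\phi(Y)([X,Z])$ for all $X,Y,Z\in\mathfrak g$. A linear map $D\colon\mathfrak g\to\mathfrak g^*$ is a derivation if $D([X,Y])(Z)=D(X)([Y,Z])-D(Y)([X,Z])$ for all $X,Y,Z\in\mathfrak g$. $\mathfrak g$ is $T^*$-solitary if every ad-invariant symmetric linear map $\phi\colon\mathfrak g\to\mathfrak g^*$ can be written as $\phi=D+{}^tD$ for some derivation $D\colon\mathfrak g\to\mathfrak g^*$. *)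

theory Defs
  imports Complex_Main
begin

locale lie_algebra = vector_space scale
  for scale :: "'k::field \<Rightarrow> 'a::ab_group_add \<Rightarrow> 'a" +
  fixes bracket :: "'a \<Rightarrow> 'a \<Rightarrow> 'a"
  assumes linear_bracket_right: "Vector_Spaces.linear scale scale (\<lambda>Y. bracket X Y)"
    and linear_bracket_left: "Vector_Spaces.linear scale scale (\<lambda>X. bracket X Y)"
    and bracket_self: "bracket X X = 0"
    and jacobi: "bracket X (bracket Y Z) + bracket Y (bracket Z X) + bracket Z (bracket X Y) = 0"
begin

primrec derived_series :: "nat \<Rightarrow> 'a set" where
  "derived_series 0 = UNIV"
| "derived_series (Suc n) =
     span {bracket X Y | X Y. X \<in> derived_series n \<and> Y \<in> derived_series n}"

definition solvable :: bool where
  "solvable \<longleftrightarrow> (\<exists>n. derived_series n = {0})"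

text \<open>
  A linear map from the Lie algebra to its dual is a curried function \<open>\<phi>\<close>. The first conjunct
  says that every \<open>\<phi> X\<close> is a linear functional; since the operations of the dual space are
  pointwise, the second one is the linearity of \<open>X \<mapsto> \<phi> X\<close>.
\<close>

definition linear_to_dual :: "('a \<Rightarrow> 'a \<Rightarrow> 'k) \<Rightarrow> bool" where
  "linear_to_dual \<phi> \<longleftrightarrow>
     (\<forall>X. Vector_Spaces.linear scale (*) (\<phi> X)) \<and>
     (\<forall>Y. Vector_Spaces.linear scale (*) (\<lambda>X. \<phi> X Y))"

definition dual_transpose :: "('a \<Rightarrow> 'a \<Rightarrow> 'k) \<Rightarrow> 'a \<Rightarrow> 'a \<Rightarrow> 'k" where
  "dual_transpose \<phi> = (\<lambda>X Y. \<phi> Y X)"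

definition symmetric :: "('a \<Rightarrow> 'a \<Rightarrow> 'k) \<Rightarrow> bool" where
  "symmetric \<phi> \<longleftrightarrow> \<phi> = dual_transpose \<phi>"

definition ad_invariant :: "('a \<Rightarrow> 'a \<Rightarrow> 'k) \<Rightarrow> bool" where
  "ad_invariant \<phi> \<longleftrightarrow> (\<forall>X Y Z. \<phi> (bracket X Y) Z = - \<phi> Y (bracket X Z))"

text \<open>Derivations with values in the dual space, regarded as the coadjoint module.\<close>

definition dual_derivation :: "('a \<Rightarrow> 'a \<Rightarrow> 'k) \<Rightarrow> bool" where
  "dual_derivation D \<longleftrightarrow> linear_to_dual D \<and>
     (\<forall>X Y Z. D (bracket X Y) Z = D X (bracket Y Z) - D Y (bracket X Z))"

definition Tstar_solitary :: bool where
  "Tstar_solitary \<longleftrightarrow>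
     (\<forall>\<phi>. linear_to_dual \<phi> \<and> ad_invariant \<phi> \<and> symmetric \<phi> \<longrightarrow>
        (\<exists>D. dual_derivation D \<and> \<phi> = (\<lambda>X Y. D X Y + dual_transpose D X Y)))"

end

locale finite_dim_lie_algebra = lie_algebra +
  assumes finite_dimensional: "\<exists>B. finite_dimensional_vector_space scale B"

end

theory Submission
  imports Defs "HOL-Computational_Algebra.Fundamental_Theorem_Algebra" "HOL-Library.Product_Plus"
begin

text \<open>
  Apply the hypothesis to the Killing form \<open>K\<close>, so that \<open>K X Y = D X Y + D Y X\<close> for a derivation \<open>D\<close>.
  On an \<open>sl2\<close>-triple \<open>(E, H, F)\<close> the derivation rule gives \<open>D H H = 2 K E F\<close>, hence
  \<open>K H H = 4 K E F\<close>, while invariance gives \<open>K H H = 2 K E F\<close>. So \<open>K H H = 0\<close>; but \<open>K H H\<close> is a sum of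
  squares of integers, one of which is \<open>2\<^sup>2\<close>. It remains to see that a nonsolvable complex Lie
  algebra contains an \<open>sl2\<close>-triple; no Levi decomposition is needed. If some nonzero abelian ideal \<open>A\<close>
  lies in the derived algebra, take a triple modulo \<open>A\<close> by induction and lift it by hand, using the
  weights of \<open>sl2\<close> on \<open>A\<close>. Otherwise the theorems of Engel and Cartan show that the radical of
  \<open>K\<close> meets the derived algebra trivially, and the argument of Jacobson and Morozov applies to an
  ad-nilpotent \<open>E\<close>. Real Lie algebras are complexified.
\<close>

section \<open>Endomorphisms and traces\<close>

text \<open>The derivation rule for \<open>[E, F]\<close>, evaluated at \<open>H\<close>, yields
  \<open>2 * (D E F + D F E)\<close>: only the symmetric part of \<open>D\<close> survives, and that
  part is \<open>K\<close>. The shape of the induction comes from quotients living on the same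
  vector space: the dimension of the space stays constant while that of the derived algebra drops,
  which is why \<open>A\<close> is sought inside the derived algebra. Lifting a triple through
  \<open>A\<close> means solving linear equations in \<open>A\<close> before all
  \<open>sl2\<close>-relations are available. They are solvable because \<open>e\<close> is
  nilpotent and \<open>h\<close> acts through nonnegative integers on the kernel of \<open>e\<close>
  and through nonpositive ones on its cokernel, up to filtrations; the same fact drives
  Jacobson-Morozov. Real endomorphisms may lack eigenvalues, so the equation between the Killing
  form and \<open>D\<close> is what is carried to the complexification.\<close>

locale endo_space = vector_space scale
  for scale :: "'k::field \<Rightarrow> 'v::ab_group_add \<Rightarrow> 'v" (infixr "*s" 75)
begin

abbreviation endo :: "('v \<Rightarrow> 'v) \<Rightarrow> bool" where
  "endo \<equiv> Vector_Spaces.linear scale scale"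

lemma endo_iff: "endo f \<longleftrightarrow> (\<forall>x y. f (x + y) = f x + f y) \<and> (\<forall>c x. f (c *s x) = c *s f x)"
  using vector_space_axioms by (auto simp: Vector_Spaces.linear_iff)

lemma endoI:
  assumes "\<And>x y. f (x + y) = f x + f y" "\<And>c x. f (c *s x) = c *s f x"
  shows "endo f"
  using assms by (simp add: endo_iff)

lemma endo_add: "endo f \<Longrightarrow> f (x + y) = f x + f y"
  and endo_scale: "endo f \<Longrightarrow> f (c *s x) = c *s f x"
  by (simp_all add: endo_iff)

lemma endo_0: "endo f \<Longrightarrow> f 0 = 0"
  and endo_neg: "endo f \<Longrightarrow> f (- x) = - f x"
  and endo_diff: "endo f \<Longrightarrow> f (x - y) = f x - f y"
  and endo_sum: "endo f \<Longrightarrow> f (sum g S) = (\<Sum>a\<in>S. f (g a))"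
  using module_hom.zero module_hom.neg module_hom.diff module_hom.sum
  by (metis module_hom_eq_linear)+

lemmas endo_simps = endo_add endo_scale endo_0 endo_neg endo_diff

lemma endo_compose: "endo f \<Longrightarrow> endo g \<Longrightarrow> endo (\<lambda>x. f (g x))"
  by (simp add: endo_iff)

lemma endo_minus: "endo f \<Longrightarrow> endo g \<Longrightarrow> endo (\<lambda>x. f x - g x)"
  by (simp add: endo_iff scale_right_diff_distrib)

lemma endo_plus: "endo f \<Longrightarrow> endo g \<Longrightarrow> endo (\<lambda>x. f x + g x)"
  by (simp add: endo_iff scale_right_distrib)

lemma endo_scaled: "endo f \<Longrightarrow> endo (\<lambda>x. c *s f x)"
  by (simp add: endo_iff scale_right_distrib mult.commute)

lemma endo_ident: "endo (\<lambda>x. x)"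
  by (simp add: endo_iff)

lemma endo_shift: "endo f \<Longrightarrow> endo (\<lambda>v. f v - c *s v)"
  by (intro endo_minus endo_scaled[OF endo_ident]) auto

lemma endo_power: "endo f \<Longrightarrow> endo (f ^^ k)"
  by (induction k) (auto simp: endo_iff)

lemma funpow_commute:
  assumes "\<And>v. f (g v) = g (f v)"
  shows "(f ^^ k) (g v) = g ((f ^^ k) v)"
  using assms by (induction k) auto

lemma funpow_eq_0_mono:
  assumes "endo f" "(f ^^ k) v = 0" "k \<le> n"
  shows "(f ^^ n) v = 0"
proof -
  have "(f ^^ n) v = (f ^^ (n - k)) ((f ^^ k) v)"
    using assms(3) by (metis comp_apply funpow_add le_add_diff_inverse2)
  then show ?thesis
    using assms endo_0[OF endo_power] by simp
qed

lemma subspace_kernel_endo: "endo f \<Longrightarrow> subspace {v. f v = 0}"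
  by (auto simp: subspace_def endo_iff endo_0)

lemma subspace_image_endo: "endo f \<Longrightarrow> subspace S \<Longrightarrow> subspace (f ` S)"
  using module_hom.subspace_image by (metis module_hom_eq_linear)

lemma endo_eq_on_span:
  assumes "endo f" "endo g" "\<And>b. b \<in> S \<Longrightarrow> f b = g b" "v \<in> span S"
  shows "f v = g v"
proof -
  have "span S \<subseteq> {v. f v - g v = 0}"
    by (intro span_minimal subspace_kernel_endo endo_minus) (use assms in auto)
  with assms(4) show ?thesis by auto
qed

lemma endo_extend:
  assumes "independent B"
  obtains g where "endo g" "\<And>b. b \<in> B \<Longrightarrow> g b = f b"
proof -
  interpret vector_space_pair scale scale ..
  show ?thesis using linear_independent_extend[OF assms, of f] that by blast
qed

text \<open>\<open>P\<close> replaces the quotient map by \<open>S\<close> without leaving the type,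
  and \<open>v - P v\<close> projects onto \<open>S\<close>. On a basis of \<open>S\<close> extended
  to the whole space, \<open>P\<close> kills the old vectors and fixes the added ones.\<close>

lemma subspace_projection:
  assumes "subspace S"
  obtains P where "endo P" "\<And>v. P (P v) = P v" "\<And>v. P v = 0 \<longleftrightarrow> v \<in> S"
proof -
  obtain B where B: "B \<subseteq> S" "independent B" "S \<subseteq> span B"
    using basis_exists[of S] by metis
  obtain C where C: "B \<subseteq> C" "independent C" "UNIV \<subseteq> span C"
    using maximal_independent_subset_extend[OF _ B(2), of UNIV] by auto
  obtain P where P: "endo P" "\<And>b. b \<in> C \<Longrightarrow> P b = (if b \<in> B then 0 else b)"
    using endo_extend[OF C(2), of "\<lambda>b. if b \<in> B then 0 else b"] by blast
  have in_C: "v \<in> span C" for v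
    using C(3) by auto
  have PP: "P (P v) = P v" for v
    by (rule endo_eq_on_span[OF endo_compose[OF P(1) P(1)] P(1) _ in_C])
       (use P in \<open>auto simp: endo_0\<close>)
  have "span C \<subseteq> {v. v - P v \<in> span B}"
  proof (rule span_minimal)
    show "C \<subseteq> {v. v - P v \<in> span B}"
      using P by (auto simp: span_base span_zero)
    have "v + w - P (v + w) = (v - P v) + (w - P w)" "c *s v - P (c *s v) = c *s (v - P v)" for v w c
      by (simp_all add: P(1) endo_simps scale_right_diff_distrib)
    note eq = this
    show "subspace {v. v - P v \<in> span B}"
      by (rule subspaceI; unfold mem_Collect_eq eq)
         (simp_all add: span_add span_scale span_zero endo_0[OF P(1)])
  qed
  moreover have "span B \<subseteq> {v. P v = 0}"
    by (intro span_minimal subspace_kernel_endo P(1)) (use P C(1) in auto)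
  moreover have "span B = S"
    using B assms by (simp add: span_subspace)
  ultimately have "P v = 0 \<longleftrightarrow> v \<in> S" for v
    using in_C[of v] by auto
  with P(1) PP show ?thesis using that by blast
qed

section \<open>Generalized eigenspaces of a single endomorphism\<close>

definition gen_eigenspace :: "('v \<Rightarrow> 'v) \<Rightarrow> 'k \<Rightarrow> 'v set" where
  "gen_eigenspace f a = {v. \<exists>k. ((\<lambda>v. f v - a *s v) ^^ k) v = 0}"

lemma gen_eigenspaceI: "((\<lambda>v. f v - a *s v) ^^ k) v = 0 \<Longrightarrow> v \<in> gen_eigenspace f a"
  by (auto simp: gen_eigenspace_def)

lemma gen_eigenspaceE:
  assumes "v \<in> gen_eigenspace f a"
  obtains k where "((\<lambda>v. f v - a *s v) ^^ k) v = 0"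
  using assms by (auto simp: gen_eigenspace_def)

lemma subspace_gen_eigenspace:
  assumes "endo f"
  shows "subspace (gen_eigenspace f a)"
proof -
  let ?g = "\<lambda>v. f v - a *s v"
  note g = endo_power[OF endo_shift[OF assms, of a]]
  show ?thesis
  proof (rule subspaceI)
    show "0 \<in> gen_eigenspace f a"
      by (rule gen_eigenspaceI[where k = 0]) simp
  next
    fix x y assume "x \<in> gen_eigenspace f a" "y \<in> gen_eigenspace f a"
    then obtain j k where "(?g ^^ j) x = 0" "(?g ^^ k) y = 0"
      by (elim gen_eigenspaceE)
    then have "(?g ^^ max j k) x = 0" "(?g ^^ max j k) y = 0"
      using funpow_eq_0_mono[OF endo_shift[OF assms, of a]] by auto
    then show "x + y \<in> gen_eigenspace f a"
      by (intro gen_eigenspaceI[where k = "max j k"]) (simp add: endo_add[OF g])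
  next
    fix c x assume "x \<in> gen_eigenspace f a"
    then obtain k where "(?g ^^ k) x = 0"
      by (elim gen_eigenspaceE)
    then show "c *s x \<in> gen_eigenspace f a"
      by (intro gen_eigenspaceI[where k = k]) (simp add: endo_scale[OF g])
  qed
qed

lemma gen_eigenspace_commute:
  assumes "endo f" "endo g" "\<And>v. f (g v) = g (f v)" "v \<in> gen_eigenspace f a"
  shows "g v \<in> gen_eigenspace f a"
proof -
  obtain k where k: "((\<lambda>v. f v - a *s v) ^^ k) v = 0"
    using assms(4) by (elim gen_eigenspaceE)
  have "((\<lambda>v. f v - a *s v) ^^ k) (g v) = g (((\<lambda>v. f v - a *s v) ^^ k) v)"
    by (rule funpow_commute) (simp add: assms endo_simps)
  with k show ?thesis
    using gen_eigenspaceI endo_0[OF assms(2)] by metis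
qed

text \<open>Induction on the number of applications of \<open>f - a\<close> that kill
  \<open>v\<close>. Passing from \<open>(f - a) v\<close> back to \<open>v\<close> replaces binomial
  expansions of powers in later arguments.\<close>

lemma gen_eigenspace_induct [consumes 2, case_names zero step]:
  assumes "endo f" and "v \<in> gen_eigenspace f a"
    and "Q 0" and "\<And>v. v \<in> gen_eigenspace f a \<Longrightarrow> Q (f v - a *s v) \<Longrightarrow> Q v"
  shows "Q v"
proof -
  obtain k where "((\<lambda>v. f v - a *s v) ^^ k) v = 0"
    using assms(2) by (elim gen_eigenspaceE)
  then show ?thesis
  proof (induction k arbitrary: v)
    case 0
    then show ?case using assms(3) by simp
  next
    case (Suc k)
    then have "((\<lambda>v. f v - a *s v) ^^ k) (f v - a *s v) = 0"
      by (simp add: funpow_Suc_right del: funpow.simps)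
    from Suc.IH[OF this] gen_eigenspaceI[OF Suc.prems] show ?case
      using assms(4) by blast
  qed
qed

lemma gen_eigenspace_eigenvector:
  assumes "endo f" "v \<in> gen_eigenspace f a" "v \<noteq> 0"
  obtains u where "u \<noteq> 0" "f u = a *s u"
proof -
  have "v \<noteq> 0 \<longrightarrow> (\<exists>u. u \<noteq> 0 \<and> f u = a *s u)"
    using assms(1,2)
  proof (induction rule: gen_eigenspace_induct)
    case (step v)
    then show ?case by (cases "f v - a *s v = 0") auto
  qed simp
  then show ?thesis using assms(3) that by blast
qed

lemma gen_eigenspace_inter:
  assumes "endo f" "a \<noteq> b" "v \<in> gen_eigenspace f a" "v \<in> gen_eigenspace f b"
  shows "v = 0"
proof -
  have "v \<in> gen_eigenspace f b \<longrightarrow> v = 0"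
    using assms(1,3)
  proof (induction rule: gen_eigenspace_induct)
    case (step v)
    show ?case
    proof
      assume v: "v \<in> gen_eigenspace f b"
      then have "f v - a *s v \<in> gen_eigenspace f b"
        using subspace_gen_eigenspace[OF assms(1)] gen_eigenspace_commute[OF assms(1) assms(1)]
        by (intro subspace_diff subspace_scale) auto
      then have fv: "f v = a *s v" using step by auto
      obtain k where k: "((\<lambda>v. f v - b *s v) ^^ k) v = 0"
        using v by (elim gen_eigenspaceE)
      have "((\<lambda>v. f v - b *s v) ^^ k) v = (a - b) ^ k *s v" for k
        by (induction k)
           (simp_all add: fv endo_simps[OF assms(1)] scale_left_diff_distrib algebra_simps)
      with k assms(2) show "v = 0" by auto
    qed
  qed simp
  with assms(4) show ?thesis by blast
qed

text \<open>On this space \<open>f - b\<close> is the nilpotent \<open>f - a\<close> plus the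
  nonzero scalar \<open>a - b\<close>, hence invertible.\<close>

lemma gen_eigenspace_shift_surj:
  assumes "endo f" "a \<noteq> b" "w \<in> gen_eigenspace f a"
  shows "\<exists>u \<in> gen_eigenspace f a. w = f u - b *s u"
  using assms(1,3)
proof (induction rule: gen_eigenspace_induct)
  case zero
  then show ?case
    using subspace_0[OF subspace_gen_eigenspace[OF assms(1)]] endo_0[OF assms(1)]
    by (intro bexI[of _ 0]) auto
next
  case (step w)
  then obtain u where u: "u \<in> gen_eigenspace f a" "f w - a *s w = f u - b *s u" by blast
  let ?u = "(1 / (a - b)) *s (w - u)"
  have "(a - b) *s w = (f w - b *s w) - (f u - b *s u)"
    by (simp add: u(2)[symmetric] scale_left_diff_distrib)
  also have "\<dots> = f (w - u) - b *s (w - u)"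
    by (simp add: assms(1) endo_simps scale_right_diff_distrib algebra_simps)
  finally have "(1 / (a - b)) *s ((a - b) *s w) = (1 / (a - b)) *s (f (w - u) - b *s (w - u))"
    by simp
  then have "w = f ?u - b *s ?u"
    using assms(2) by (simp add: assms(1) endo_simps scale_right_diff_distrib mult.commute)
  moreover have "?u \<in> gen_eigenspace f a"
    using step u subspace_gen_eigenspace[OF assms(1)]
    by (intro subspace_scale subspace_diff) auto
  ultimately show ?case by blast
qed

text \<open>A power of \<open>f - b\<close> kills the summand for \<open>b\<close> and keeps the
  others in their spaces, so the induction hypothesis applies to the images. Each remaining
  \<open>v a\<close> is then killed by a power of \<open>f - b\<close> as well, and
  \<open>gen_eigenspace_inter\<close> applies.\<close>

lemma gen_eigenspaces_independent:
  assumes "endo f" "finite L" "\<And>a. a \<in> L \<Longrightarrow> v a \<in> gen_eigenspace f a" "(\<Sum>a\<in>L. v a) = 0"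
    and "a \<in> L"
  shows "v a = 0"
  using assms(2-)
proof (induction L arbitrary: v a rule: finite_induct)
  case (insert b L)
  let ?g = "\<lambda>v. f v - b *s v"
  obtain k where k: "(?g ^^ k) (v b) = 0"
    using insert.prems(1)[of b] by (auto elim: gen_eigenspaceE)
  note g = endo_power[OF endo_shift[OF assms(1), of b]]
  have gv: "(?g ^^ k) (v a) \<in> gen_eigenspace f a" if "a \<in> L" for a
    using insert.prems(1)[of a] that
    by (intro gen_eigenspace_commute[OF assms(1) g] funpow_commute[symmetric])
       (auto simp: assms(1) endo_simps)
  have "(?g ^^ k) (v b + (\<Sum>a\<in>L. v a)) = 0"
    using insert by (simp add: endo_0[OF g])
  then have "(\<Sum>a\<in>L. (?g ^^ k) (v a)) = 0"
    by (simp add: endo_add[OF g] endo_sum[OF g] k)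
  then have "(?g ^^ k) (v a) = 0" if "a \<in> L" for a
    using insert.IH[of "\<lambda>a. (?g ^^ k) (v a)"] gv that by blast
  then have "v a \<in> gen_eigenspace f b" if "a \<in> L" for a
    using that gen_eigenspaceI by blast
  then have L: "v a = 0" if "a \<in> L" for a
    using that insert gen_eigenspace_inter[OF assms(1), of a b] by (metis insertCI)
  with insert.prems(2) insert.hyps have "v b = 0" by simp
  with L insert.prems(3) show ?case by blast
qed simp

definition poly_endo :: "'k poly \<Rightarrow> ('v \<Rightarrow> 'v) \<Rightarrow> 'v \<Rightarrow> 'v" where
  "poly_endo p f v = (\<Sum>i\<le>degree p. coeff p i *s (f ^^ i) v)"

lemma poly_endo_altdef:
  assumes "degree p \<le> n"
  shows "poly_endo p f v = (\<Sum>i\<le>n. coeff p i *s (f ^^ i) v)"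
  unfolding poly_endo_def using assms
  by (intro sum.mono_neutral_left) (auto simp: coeff_eq_0)

lemma poly_endo_linear_factor:
  assumes "endo f"
  shows "poly_endo ([:- a, 1:] * q) f v = poly_endo q f (f v - a *s v)"
proof -
  let ?n = "Suc (degree q)"
  have deg: "degree ([:- a, 1:] * q) \<le> ?n"
    using degree_mult_le[of "[:- a, 1:]" q] by simp
  have eq: "[:- a, 1:] * q = pCons 0 q - smult a q"
    by simp
  have "poly_endo ([:- a, 1:] * q) f v = (\<Sum>i\<le>?n. coeff (pCons 0 q - smult a q) i *s (f ^^ i) v)"
    using poly_endo_altdef[OF deg] unfolding eq .
  also have "\<dots> = (\<Sum>i\<le>?n. coeff (pCons 0 q) i *s (f ^^ i) v)
      - (\<Sum>i\<le>?n. (a * coeff q i) *s (f ^^ i) v)"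
    by (simp only: coeff_diff coeff_smult scale_left_diff_distrib sum_subtractf)
  also have "(\<Sum>i\<le>?n. coeff (pCons 0 q) i *s (f ^^ i) v) = poly_endo q f (f v)"
    by (simp add: sum.atMost_Suc_shift poly_endo_def funpow_swap1 del: sum.atMost_Suc)
  also have "(\<Sum>i\<le>?n. (a * coeff q i) *s (f ^^ i) v) = poly_endo q f (a *s v)"
    using endo_power[OF assms] by (simp add: coeff_eq_0 poly_endo_def endo_scale mult.commute)
  finally show ?thesis
    by (simp add: poly_endo_def endo_diff[OF endo_power[OF assms]] scale_right_diff_distrib sum_subtractf)
qed

definition trace :: "'v set \<Rightarrow> ('v \<Rightarrow> 'v) \<Rightarrow> 'k" where
  "trace B f = (\<Sum>b\<in>B. representation B (f b) b)"

lemma gen_eigenspace_stepD: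
  assumes "f v - a *s v \<in> gen_eigenspace f a"
  shows "v \<in> gen_eigenspace f a"
proof -
  obtain k where "((\<lambda>v. f v - a *s v) ^^ k) (f v - a *s v) = 0"
    using assms by (elim gen_eigenspaceE)
  then have "((\<lambda>v. f v - a *s v) ^^ Suc k) v = 0"
    by (simp add: funpow_Suc_right del: funpow.simps)
  then show ?thesis by (rule gen_eigenspaceI)
qed

lemma gen_eigenspace_raise:
  assumes "endo f" "endo d" "\<And>v. f (d v) = d (f v) + c *s d v" "v \<in> gen_eigenspace f a"
  shows "d v \<in> gen_eigenspace f (a + c)"
  using assms(1,4)
proof (induction rule: gen_eigenspace_induct)
  case zero
  then show ?case
    using subspace_0[OF subspace_gen_eigenspace[OF assms(1)]] by (simp add: endo_0[OF assms(2)])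
next
  case (step v)
  have "f (d v) - (a + c) *s d v = d (f v - a *s v)"
    unfolding assms(3) by (simp add: endo_diff[OF assms(2)] endo_scale[OF assms(2)] scale_left_distrib)
  with step(2) show ?case by (metis gen_eigenspace_stepD)
qed

lemma gen_eigenspace_raise_power:
  assumes "endo f" "endo d" "\<And>v. f (d v) = d (f v) + c *s d v" "v \<in> gen_eigenspace f a"
  shows "(d ^^ k) v \<in> gen_eigenspace f (a + of_nat k * c)"
proof (induction k)
  case (Suc k)
  from gen_eigenspace_raise[OF assms(1-3) this] show ?case by (simp add: algebra_simps)
qed (simp add: assms)

end

section \<open>Traces, annihilating polynomials and linear functionals in finite dimension\<close>

locale fd_endo_space = endo_space scale + finite_dimensional_vector_space scale Basis
  for scale :: "'k::field \<Rightarrow> 'v::ab_group_add \<Rightarrow> 'v" (infixr "*s" 75) and Basis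
begin

lemma representation_sum_basis:
  assumes "independent B" "span B = UNIV"
  shows "(\<Sum>b\<in>B. representation B v b *s b) = v"
  using assms by (intro sum_representation_eq) (auto simp: finiteI_independent)

lemma representation_lin:
  assumes "independent B" "span B = UNIV"
  shows "representation B (x + y) b = representation B x b + representation B y b"
    "representation B (x - y) b = representation B x b - representation B y b"
    "representation B (c *s x) b = c * representation B x b"
    "representation B (sum g S) b = (\<Sum>a\<in>S. representation B (g a) b)"
  using assms by (simp_all add: representation_add representation_diff representation_scale
      representation_sum)

lemma representation_endo:
  assumes "independent B" "span B = UNIV" "independent C" "span C = UNIV" "endo f"
  shows "representation B (f v) b = (\<Sum>c\<in>C. representation C v c * representation B (f c) b)"
proof -
  have "f v = (\<Sum>c\<in>C. representation C v c *s f c)"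
    using endo_sum[OF assms(5), of "\<lambda>c. representation C v c *s c" C]
    by (simp add: representation_sum_basis[OF assms(3,4)] endo_scale[OF assms(5)])
  then show ?thesis
    by (simp add: representation_lin[OF assms(1,2)])
qed

lemma trace_basis_eq:
  assumes "independent B" "span B = UNIV" "independent C" "span C = UNIV" "endo f"
  shows "trace B f = trace C f"
proof -
  have "trace B f = (\<Sum>b\<in>B. \<Sum>c\<in>C. representation C b c * representation B (f c) b)"
    unfolding trace_def by (intro sum.cong refl representation_endo[OF assms])
  also have "\<dots> = (\<Sum>c\<in>C. \<Sum>b\<in>B. representation B (f c) b * representation C b c)"
    by (subst sum.swap) (simp add: mult.commute)
  also have "\<dots> = trace C f"
    unfolding trace_def
    by (intro sum.cong refl representation_endo[OF assms(3,4,1,2) endo_ident, symmetric])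
  finally show ?thesis .
qed

lemma trace_commute:
  assumes "independent B" "span B = UNIV" "endo f" "endo g"
  shows "trace B (\<lambda>v. f (g v)) = trace B (\<lambda>v. g (f v))"
proof -
  have "trace B (\<lambda>v. f (g v)) = (\<Sum>b\<in>B. \<Sum>c\<in>B. representation B (g b) c * representation B (f c) b)"
    unfolding trace_def by (intro sum.cong refl representation_endo[OF assms(1,2,1,2,3)])
  also have "\<dots> = (\<Sum>c\<in>B. \<Sum>b\<in>B. representation B (f c) b * representation B (g b) c)"
    by (subst sum.swap) (simp add: mult.commute)
  also have "\<dots> = trace B (\<lambda>v. g (f v))"
    unfolding trace_def
    by (intro sum.cong refl representation_endo[OF assms(1,2,1,2,4), symmetric])
  finally show ?thesis .
qed

lemma trace_lin:
  assumes "independent B" "span B = UNIV"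
  shows "trace B (\<lambda>v. f v + g v) = trace B f + trace B g"
    "trace B (\<lambda>v. f v - g v) = trace B f - trace B g"
    "trace B (\<lambda>v. c *s f v) = c * trace B f"
  by (simp_all add: trace_def representation_lin[OF assms] sum.distrib sum_subtractf sum_distrib_left)

text \<open>A basis adapted to the kernels of the powers of \<open>f\<close> is built by successive
  extension: \<open>f\<close> sends each new vector into the span of the earlier ones, so all
  diagonal entries vanish.\<close>

lemma trace_nilpotent:
  assumes "independent B" "span B = UNIV" "endo f" "\<And>v. (f ^^ n) v = 0"
  shows "trace B f = 0"
proof -
  have "\<exists>C. independent C \<and> span C = {v. (f ^^ k) v = 0} \<and> (\<forall>c\<in>C. f c \<in> span (C - {c}))" for k
  proof (induction k)
    case 0
    then show ?case by (intro exI[of _ "{}"]) (auto simp: independent_empty)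
  next
    case (Suc k)
    then obtain C where C: "independent C" "span C = {v. (f ^^ k) v = 0}"
      "\<And>c. c \<in> C \<Longrightarrow> f c \<in> span (C - {c})" by blast
    let ?K = "{v. (f ^^ Suc k) v = 0}"
    have K: "subspace ?K" by (rule subspace_kernel_endo[OF endo_power[OF assms(3)]])
    have "C \<subseteq> span C" by (rule span_superset)
    then have "C \<subseteq> ?K" using C(2) endo_0[OF assms(3)] by auto
    then obtain C' where C': "C \<subseteq> C'" "C' \<subseteq> ?K" "independent C'" "?K \<subseteq> span C'"
      using maximal_independent_subset_extend[OF _ C(1), of ?K] by metis
    have "f c \<in> span (C' - {c})" if c: "c \<in> C'" for c
    proof (cases "c \<in> C")
      case True
      then show ?thesis using C(3)[OF True] span_mono[of "C - {c}" "C' - {c}"] C'(1) by blast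
    next
      case False
      have "(f ^^ k) (f c) = 0" using c C'(2) by (auto simp: funpow_swap1)
      then have "f c \<in> span C" using C(2) by auto
      then show ?thesis using span_mono[of C "C' - {c}"] C'(1) False by blast
    qed
    moreover have "span C' = ?K" using C' K by (simp add: span_subspace)
    ultimately show ?case using C'(3) by blast
  qed
  from this[of n] obtain C where C: "independent C" "span C = UNIV"
    "\<And>c. c \<in> C \<Longrightarrow> f c \<in> span (C - {c})" using assms(4) by auto
  have "representation C (f c) c = 0" if c: "c \<in> C" for c
  proof -
    have "representation C (f c) = representation (C - {c}) (f c)"
      by (rule representation_extend) (use C(1) C(3)[OF c] in auto)
    then show ?thesis using representation_ne_zero[of "C - {c}" "f c" c] by auto
  qed
  then have "trace C f = 0" by (simp add: trace_def)
  then show ?thesis using trace_basis_eq[OF assms(1,2) C(1,2) assms(3)] by simp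
qed

text \<open>The vectors \<open>v, f v, f (f v), ...\<close> cannot all be independent of their
  predecessors; a dependence of \<open>(f ^^ k) v\<close> on the earlier ones is a monic polynomial
  of degree \<open>k\<close>.\<close>

lemma exists_poly_endo_eq_0:
  assumes "endo f"
  obtains p where "p \<noteq> 0" "poly_endo p f v = 0"
proof -
  let ?W = "\<lambda>k. (\<lambda>i. (f ^^ i) v) ` {..<k}"
  have "\<exists>k. (f ^^ k) v \<in> span (?W k)"
  proof (rule ccontr)
    assume *: "\<nexists>k. (f ^^ k) v \<in> span (?W k)"
    have "dim (?W k) = k" for k
      by (induction k) (use * in \<open>simp_all add: lessThan_Suc dim_insert\<close>)
    with dim_subset_UNIV[of "?W (Suc dimension)"] show False by simp
  qed
  then obtain k where k: "(f ^^ k) v \<in> span (?W k)" by blast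
  have "span (?W k) \<subseteq> {\<Sum>i<k. c i *s (f ^^ i) v | c. True}" (is "_ \<subseteq> ?R")
  proof (rule span_minimal)
    show "?W k \<subseteq> ?R"
    proof clarify
      fix j assume "j < k"
      then have "(f ^^ j) v = (\<Sum>i<k. (if i = j then 1 else 0) *s (f ^^ i) v)"
        by (simp add: if_distrib[of "\<lambda>c. c *s _"] cong: if_cong)
      then show "\<exists>c. (f ^^ j) v = (\<Sum>i<k. c i *s (f ^^ i) v) \<and> True"
        by (intro exI[of _ "\<lambda>i. if i = j then 1 else 0"]) simp
    qed
    show "subspace ?R"
    proof (rule subspaceI)
      show "0 \<in> ?R" by (auto intro!: exI[of _ "\<lambda>_. 0"])
    next
      fix x y assume "x \<in> ?R" "y \<in> ?R"
      then obtain c d where "x = (\<Sum>i<k. c i *s (f ^^ i) v)" "y = (\<Sum>i<k. d i *s (f ^^ i) v)" by auto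
      then have "x + y = (\<Sum>i<k. (c i + d i) *s (f ^^ i) v)"
        by (simp add: scale_left_distrib sum.distrib)
      then show "x + y \<in> ?R" by (auto intro!: exI[of _ "\<lambda>i. c i + d i"])
    next
      fix a x assume "x \<in> ?R"
      then obtain c where "x = (\<Sum>i<k. c i *s (f ^^ i) v)" by auto
      then have "a *s x = (\<Sum>i<k. (a * c i) *s (f ^^ i) v)"
        by (simp add: scale_sum_right)
      then show "a *s x \<in> ?R" by (auto intro!: exI[of _ "\<lambda>i. a * c i"])
    qed
  qed
  then obtain c where c: "(f ^^ k) v = (\<Sum>i<k. c i *s (f ^^ i) v)" using k by auto
  define p where "p = monom 1 k - (\<Sum>i<k. monom (c i) i)"
  have cf: "coeff p i = (if i = k then 1 else if i < k then - c i else 0)" for i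
    by (simp add: p_def coeff_sum)
  then have "degree p \<le> k" by (intro degree_le) auto
  then have "poly_endo p f v = (\<Sum>i\<le>k. coeff p i *s (f ^^ i) v)"
    by (rule poly_endo_altdef)
  also have "{..k} = insert k {..<k}" by auto
  also have "(\<Sum>i\<in>insert k {..<k}. coeff p i *s (f ^^ i) v) = (f ^^ k) v + (\<Sum>i<k. - (c i *s (f ^^ i) v))"
    by (simp add: cf)
  also have "\<dots> = 0" using c by (simp add: sum_negf)
  finally have "poly_endo p f v = 0" .
  moreover have "p \<noteq> 0" using cf[of k] by auto
  ultimately show ?thesis using that by blast
qed

text \<open>If \<open>h\<close> vanishes on the common kernel of \<open>A\<close>, it contributes
  nothing. Otherwise some \<open>u\<close> in that kernel has \<open>h u\<close> nonzero, and
  subtracting a multiple of \<open>h\<close> from \<open>f\<close> reduces the claim to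
  \<open>A\<close>.\<close>

lemma functional_eq_combination:
  fixes A :: "('v \<Rightarrow> 'k) set"
  assumes "finite A" "\<And>g. g \<in> insert f A \<Longrightarrow> Vector_Spaces.linear scale (*) g"
    and "\<And>v. (\<And>g. g \<in> A \<Longrightarrow> g v = 0) \<Longrightarrow> f v = 0"
  shows "\<exists>c. \<forall>v. f v = (\<Sum>g\<in>A. c g * g v)"
  using assms
proof (induction A arbitrary: f rule: finite_induct)
  case (insert h A)
  have lin: "g (x + y) = g x + g y" "g (r *s x) = r * g x" if "g \<in> insert f (insert h A)" for g x y r
    using insert.prems(1)[OF that] by (auto simp: Vector_Spaces.linear_iff)
  show ?case
  proof (cases "\<forall>v. (\<forall>g\<in>A. g v = 0) \<longrightarrow> h v = 0")
    case True
    then have "\<exists>c. \<forall>v. f v = (\<Sum>g\<in>A. c g * g v)"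
    proof (intro insert.IH)
      fix v assume "\<And>g. g \<in> A \<Longrightarrow> g v = 0"
      with True have "g v = 0" if "g \<in> insert h A" for g using that by auto
      then show "f v = 0" by (rule insert.prems(2))
    qed (use insert.prems(1) in auto)
    then obtain c where c: "\<forall>v. f v = (\<Sum>g\<in>A. c g * g v)" by blast
    \<comment> \<open>The value \<open>c h\<close> obtained from the induction is arbitrary, so it
      is reset to \<open>0\<close>.\<close>
    have "(\<Sum>g\<in>insert h A. (c(h := 0)) g * g v) = (\<Sum>g\<in>A. c g * g v)" for v
      using insert.hyps by simp (intro sum.cong, auto)
    with c show ?thesis by (intro exI[of _ "c(h := 0)"]) simp
  next
    case False
    then obtain u where u: "\<forall>g\<in>A. g u = 0" "h u \<noteq> 0" by blast
    let ?f = "\<lambda>v. f v - f u / h u * h v"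
    have "\<exists>c. \<forall>v. ?f v = (\<Sum>g\<in>A. c g * g v)"
    proof (rule insert.IH)
      fix g assume "g \<in> insert ?f A"
      moreover have "Vector_Spaces.linear scale (*) ?f"
        using insert.prems(1)[of h] unfolding Vector_Spaces.linear_iff
        by (simp add: lin algebra_simps add_divide_distrib)
      ultimately show "Vector_Spaces.linear scale (*) g"
        using insert.prems(1) by blast
    next
      fix v assume v: "\<And>g. g \<in> A \<Longrightarrow> g v = 0"
      \<comment> \<open>Shifting \<open>v\<close> along \<open>u\<close> puts it into the kernel of
        \<open>h\<close> and leaves the values of all functionals in \<open>A\<close>
        unchanged.\<close>
      let ?w = "v + (- (h v / h u)) *s u"
      have "f ?w = 0"
      proof (rule insert.prems(2))
        fix g assume g: "g \<in> insert h A"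
        have "g ?w = g v + (- (h v / h u)) * g u" by (simp only: lin[OF insertI2[OF g]])
        then show "g ?w = 0" using u v g by auto
      qed
      moreover have "f ?w = f v + (- (h v / h u)) * f u" by (simp only: lin[OF insertI1])
      ultimately show "?f v = 0" by (simp add: mult.commute)
    qed
    then obtain c where c: "\<And>v. ?f v = (\<Sum>g\<in>A. c g * g v)" by blast
    have "f v = (\<Sum>g\<in>insert h A. (c(h := f u / h u)) g * g v)" for v
    proof -
      have "(\<Sum>g\<in>A. (c(h := f u / h u)) g * g v) = (\<Sum>g\<in>A. c g * g v)"
        using insert.hyps by (intro sum.cong) auto
      then show ?thesis using c[of v] insert.hyps by (simp add: algebra_simps)
    qed
    then show ?thesis by blast
  qed
qed simp

lemma nilpotent_if_locally_nilpotent: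
  assumes "endo f" "span S = UNIV" "\<And>v. v \<in> S \<Longrightarrow> \<exists>k. (f ^^ k) v = 0"
  obtains n where "\<And>v. (f ^^ n) v = 0"
proof -
  have "S \<subseteq> gen_eigenspace f 0"
    using assms(3) by (auto simp: gen_eigenspace_def)
  then have "span S \<subseteq> gen_eigenspace f 0"
    by (intro span_minimal subspace_gen_eigenspace assms(1))
  then have "\<exists>k. (f ^^ k) v = 0" for v
    using assms(2) by (auto simp: gen_eigenspace_def)
  then obtain K where K: "\<And>v. (f ^^ K v) v = 0" by metis
  define n where "n = Max (K ` Basis)"
  have "(f ^^ n) b = 0" if "b \<in> Basis" for b
    using funpow_eq_0_mono[OF assms(1) K, of b n] that finite_Basis by (simp add: n_def)
  then have "(f ^^ n) v = 0" for v
    using endo_eq_on_span[OF endo_power[OF assms(1), of n] endo_scaled[OF endo_ident, of 0], of Basis v]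
    by (simp add: span_Basis)
  then show ?thesis using that by blast
qed

lemma representation_Basis_eqI:
  assumes "v = (\<Sum>b\<in>Basis. c b *s b)" "b \<in> Basis"
  shows "representation Basis v b = c b"
proof -
  have "representation Basis v b = (\<Sum>b'\<in>Basis. c b' * representation Basis b' b)"
    unfolding assms(1) by (simp add: representation_lin[OF independent_Basis span_Basis])
  also have "\<dots> = (\<Sum>b'\<in>Basis. if b = b' then c b' else 0)"
    by (intro sum.cong refl) (auto simp: representation_basis[OF independent_Basis])
  also have "\<dots> = c b" using assms(2) finite_Basis by simp
  finally show ?thesis .
qed

end

section \<open>Generalized eigenspaces over the complex numbers\<close>

locale complex_endo_space = fd_endo_space scale Basis
  for scale :: "complex \<Rightarrow> 'v::ab_group_add \<Rightarrow> 'v" (infixr "*s" 75) and Basis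
begin

text \<open>Induction on the degree of a polynomial annihilating \<open>v\<close>: splitting off a
  root \<open>a\<close> shows that \<open>(f - a) v\<close> lies in the span, and
  \<open>surj\<close> solves \<open>(f - a) u = (f - a) v\<close> within the span up to an error in
  the space of \<open>a\<close>. Then \<open>v - u\<close> lies in that space too.\<close>

lemma span_gen_eigenspaces:
  assumes "endo f"
  shows "v \<in> span (\<Union>a. gen_eigenspace f a)" (is "v \<in> ?G")
proof -
  \<comment> \<open>On the spaces of other eigenvalues \<open>f - a\<close> is onto; on the space of
    \<open>a\<close> the error term absorbs everything, with \<open>u = 0\<close>.\<close>
  have surj: "\<exists>u\<in>?G. w - (f u - a *s u) \<in> gen_eigenspace f a" if "w \<in> ?G" for w a
    using that
  proof (induction rule: span_induct)
    case base
    note sub = subspace_gen_eigenspace[OF assms, of a]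
    show ?case
    proof (rule subspaceI, goal_cases)
      case 1
      show ?case using span_zero endo_0[OF assms] subspace_0[OF sub] by (auto intro!: bexI[of _ 0])
    next
      case (2 x y)
      then obtain u w where *: "u \<in> ?G" "x - (f u - a *s u) \<in> gen_eigenspace f a"
        "w \<in> ?G" "y - (f w - a *s w) \<in> gen_eigenspace f a" by auto
      have "x + y - (f (u + w) - a *s (u + w)) = (x - (f u - a *s u)) + (y - (f w - a *s w))"
        by (simp add: endo_add[OF assms] scale_right_distrib)
      then show ?case using * span_add subspace_add[OF sub] by (metis (no_types, lifting) mem_Collect_eq)
    next
      case (3 c x)
      then obtain u where *: "u \<in> ?G" "x - (f u - a *s u) \<in> gen_eigenspace f a" by auto
      have "c *s x - (f (c *s u) - a *s (c *s u)) = c *s (x - (f u - a *s u))"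
        by (simp add: endo_scale[OF assms] scale_right_diff_distrib mult.commute)
      then show ?case using * span_scale subspace_scale[OF sub] by (metis (no_types, lifting) mem_Collect_eq)
    qed
  next
    case (step w)
    then obtain b where b: "w \<in> gen_eigenspace f b" by auto
    show ?case
    proof (cases "a = b")
      case True
      then show ?thesis using b span_zero endo_0[OF assms] by (auto intro!: bexI[of _ 0])
    next
      case False
      then obtain u where u: "u \<in> gen_eigenspace f b" "w = f u - a *s u"
        using gen_eigenspace_shift_surj[OF assms _ b, of a] by auto
      then have "u \<in> ?G" by (intro span_base) auto
      then show ?thesis using u subspace_0[OF subspace_gen_eigenspace[OF assms]] by (intro bexI[of _ u]) auto
    qed
  qed
  have "p \<noteq> 0 \<Longrightarrow> poly_endo p f v = 0 \<Longrightarrow> v \<in> ?G" for p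
  proof (induction "degree p" arbitrary: p v)
    case 0
    then have "coeff p 0 *s v = 0" "coeff p 0 \<noteq> 0"
      by (auto simp: poly_endo_def leading_coeff_0_iff[symmetric] simp del: leading_coeff_0_iff)
    then show ?case by (simp add: span_zero)
  next
    case (Suc n)
    then have "\<not> constant (poly p)" by (simp add: constant_degree)
    then obtain a where "poly p a = 0" using fundamental_theorem_of_algebra by blast
    then obtain q where q: "p = [:- a, 1:] * q" by (auto simp: poly_eq_0_iff_dvd)
    with Suc have "q \<noteq> 0" by auto
    then have "degree p = degree q + 1" unfolding q by (subst degree_mult_eq) auto
    then have "f v - a *s v \<in> ?G"
      using Suc poly_endo_linear_factor[OF assms, of a q v] \<open>q \<noteq> 0\<close> q by auto
    then obtain u where u: "u \<in> ?G" "f v - a *s v - (f u - a *s u) \<in> gen_eigenspace f a"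
      using surj by blast
    have "f v - a *s v - (f u - a *s u) = f (v - u) - a *s (v - u)"
      by (simp add: endo_diff[OF assms] scale_right_diff_distrib)
    with u(2) obtain k where "((\<lambda>v. f v - a *s v) ^^ k) (f (v - u) - a *s (v - u)) = 0"
      by (auto elim: gen_eigenspaceE)
    then have "((\<lambda>v. f v - a *s v) ^^ Suc k) (v - u) = 0"
      by (simp add: funpow_Suc_right del: funpow.simps)
    then have "v - u \<in> ?G" using gen_eigenspaceI by (intro span_base UN_I) (rule UNIV_I)
    then have "(v - u) + u \<in> ?G" using u(1) by (rule span_add)
    then show ?case by simp
  qed
  then show ?thesis using exists_poly_endo_eq_0[OF assms] by metis
qed

lemma gen_eigenbasis_exists:
  assumes "endo f"
  obtains B ev where "independent B" "span B = UNIV" "\<And>b. b \<in> B \<Longrightarrow> b \<in> gen_eigenspace f (ev b)"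
proof -
  obtain B where B: "B \<subseteq> (\<Union>a. gen_eigenspace f a)" "independent B" "(\<Union>a. gen_eigenspace f a) \<subseteq> span B"
    using maximal_independent_subset[of "\<Union>a. gen_eigenspace f a"] by metis
  have "span (\<Union>a. gen_eigenspace f a) \<subseteq> span B"
    using B(3) by (intro span_minimal) auto
  then have "span B = UNIV" using span_gen_eigenspaces[OF assms] by auto
  moreover have "\<forall>b\<in>B. \<exists>a. b \<in> gen_eigenspace f a" using B(1) by auto
  ultimately show ?thesis using that B(2) by metis
qed

section \<open>Consequences of a fixed basis of generalized eigenvectors\<close>

context
  fixes f B ev
  assumes f: "endo f" and B: "independent B" "span B = UNIV"
    and ev: "\<And>b. b \<in> B \<Longrightarrow> b \<in> gen_eigenspace f (ev b)"
begin

lemma gen_eigenspace_span_basis: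
  assumes "v \<in> gen_eigenspace f a"
  shows "v \<in> span {b \<in> B. ev b = a}"
proof -
  \<comment> \<open>\<open>w m\<close> is the part of \<open>v\<close> along the basis vectors of
    eigenvalue \<open>m\<close>, diminished by \<open>v\<close> itself when \<open>m = a\<close>.
    These vectors sum to \<open>0\<close>, so independence of the spaces makes them vanish. The
    index \<open>a\<close> is inserted below because it may not be a value of
    \<open>ev\<close>.\<close>
  define w where "w = (\<lambda>m. (\<Sum>b\<in>{b \<in> B. ev b = m}. representation B v b *s b) - (if m = a then v else 0))"
  have fin: "finite B" using B finiteI_independent by blast
  have "w a = 0"
  proof (rule gen_eigenspaces_independent[OF f])
    show "finite (insert a (ev ` B))" using fin by simp
    note sub = subspace_gen_eigenspace[OF f]
    show "w m \<in> gen_eigenspace f m" for m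
      unfolding w_def using ev assms
      by (intro subspace_diff[OF sub] subspace_sum[OF sub] subspace_scale[OF sub]) (auto simp: subspace_0[OF sub])
    have "(\<Sum>m\<in>insert a (ev ` B). w m) = (\<Sum>b\<in>B. representation B v b *s b) - v"
      unfolding w_def sum_subtractf using fin
      by (subst sum.group) (auto simp del: sum.insert)
    then show "(\<Sum>m\<in>insert a (ev ` B). w m) = 0"
      by (simp add: representation_sum_basis[OF B])
  qed simp
  then have "v = (\<Sum>b\<in>{b \<in> B. ev b = a}. representation B v b *s b)" by (simp add: w_def)
  then show ?thesis
    by (metis (no_types, lifting) span_sum span_scale span_base)
qed

lemma gen_eigenspace_trivial: "a \<notin> ev ` B \<Longrightarrow> v \<in> gen_eigenspace f a \<Longrightarrow> v = 0"
  using gen_eigenspace_span_basis[of v a] by (cases "{b \<in> B. ev b = a} = {}") (auto simp: image_iff)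

lemma finite_basis_eigenvalues: "finite (ev ` B)"
  using B finiteI_independent by blast

text \<open>The diagonal map \<open>s\<close>, acting by \<open>c a\<close> on the space of
  \<open>a\<close>, differs from \<open>m\<close> by a nilpotent map, so the traces agree. Later
  \<open>m\<close> is \<open>ad X\<close> after its conjugate semisimple part, or the square of
  \<open>ad H\<close>.\<close>

lemma trace_eq_sum_eigenvalues:
  assumes "independent C" "span C = UNIV" "endo m"
    and "\<And>a v. v \<in> gen_eigenspace f a \<Longrightarrow> m v \<in> gen_eigenspace f a"
    and "\<And>a v. v \<in> gen_eigenspace f a \<Longrightarrow> v \<in> gen_eigenspace m (c a)"
  shows "trace C m = (\<Sum>b\<in>B. c (ev b))"
proof -
  obtain s where s: "endo s" "\<And>b. b \<in> B \<Longrightarrow> s b = c (ev b) *s b"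
    using endo_extend[OF B(1), of "\<lambda>b. c (ev b) *s b"] by blast
  have s_eq: "s v = c a *s v" if "v \<in> gen_eigenspace f a" for v a
    by (rule endo_eq_on_span[OF s(1) endo_scaled[OF endo_ident] _ gen_eigenspace_span_basis[OF that]])
       (auto simp: s(2))
  have ms: "endo (\<lambda>v. m v - s v)" by (rule endo_minus[OF assms(3) s(1)])
  have pow: "((\<lambda>v. m v - s v) ^^ k) v = ((\<lambda>v. m v - c a *s v) ^^ k) v
      \<and> ((\<lambda>v. m v - c a *s v) ^^ k) v \<in> gen_eigenspace f a"
    if "v \<in> gen_eigenspace f a" for v a k
  proof (induction k)
    case (Suc k)
    then show ?case
      using assms(4) s_eq subspace_gen_eigenspace[OF f] by (auto intro!: subspace_diff subspace_scale)
  qed (simp add: that)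
  obtain n where n: "\<And>v. ((\<lambda>v. m v - s v) ^^ n) v = 0"
  proof (rule nilpotent_if_locally_nilpotent[OF ms, of B])
    fix b assume "b \<in> B"
    with ev assms(5) have "b \<in> gen_eigenspace m (c (ev b))" by blast
    then show "\<exists>k. ((\<lambda>v. m v - s v) ^^ k) b = 0"
      using pow[OF ev[OF \<open>b \<in> B\<close>]] by (metis gen_eigenspaceE)
  qed (use B in auto)
  have "trace B m = trace B (\<lambda>v. (m v - s v) + s v)" by simp
  also have "\<dots> = trace B s"
    using trace_nilpotent[OF B ms n] trace_lin(1)[OF B, of "\<lambda>v. m v - s v" s] by simp
  also have "\<dots> = (\<Sum>b\<in>B. c (ev b))"
    unfolding trace_def using s(2) B by (intro sum.cong) (simp_all add: representation_lin(3) representation_basis)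
  finally show ?thesis using trace_basis_eq[OF assms(1,2) B assms(3)] by simp
qed

lemma spectral_endo:
  obtains s where "endo s" "\<And>a v. v \<in> gen_eigenspace f a \<Longrightarrow> s v = c a *s v"
proof -
  obtain s where s: "endo s" "\<And>b. b \<in> B \<Longrightarrow> s b = c (ev b) *s b"
    using endo_extend[OF B(1), of "\<lambda>b. c (ev b) *s b"] by blast
  have s_eq: "s v = c a *s v" if "v \<in> gen_eigenspace f a" for v a
    by (rule endo_eq_on_span[OF s(1) endo_scaled[OF endo_ident] _ gen_eigenspace_span_basis[OF that]])
       (auto simp: s(2))
  with s(1) show ?thesis using that by blast
qed

end

text \<open>\<open>e\<close> shifts the eigenvalues of \<open>h\<close> by \<open>c\<close>. As
  there are finitely many, the progression \<open>ev b + k * c\<close> leaves them at some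
  \<open>k\<close>, where \<open>(e ^^ k) b\<close> must vanish.\<close>

lemma raising_nilpotent:
  assumes "endo h" "endo e" "\<And>v. h (e v) = e (h v) + c *s e v" "c \<noteq> 0"
  obtains n where "\<And>v. (e ^^ n) v = 0"
proof -
  obtain B ev where B: "independent B" "span B = UNIV" "\<And>b. b \<in> B \<Longrightarrow> b \<in> gen_eigenspace h (ev b)"
    using gen_eigenbasis_exists[OF assms(1)] by blast
  show ?thesis
  proof (rule nilpotent_if_locally_nilpotent[OF assms(2) B(2)])
    fix b assume b: "b \<in> B"
    have "inj (\<lambda>k. ev b + of_nat k * c)" using assms(4) by (auto simp: inj_def)
    then have "\<not> range (\<lambda>k. ev b + of_nat k * c) \<subseteq> ev ` B"
      using finite_basis_eigenvalues[OF assms(1) B] finite_subset infinite_iff_countable_subset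
      by (metis range_inj_infinite)
    then obtain k where "ev b + of_nat k * c \<notin> ev ` B" by blast
    then have "(e ^^ k) b = 0"
      using gen_eigenspace_trivial[OF assms(1) B] gen_eigenspace_raise_power[OF assms(1-3) B(3)[OF b]] by blast
    then show "\<exists>k. (e ^^ k) b = 0" ..
  qed (use that in blast)
qed

end

section \<open>Actions of \<open>sl2\<close>\<close>

text \<open>
  The relation between \<open>h\<close> and \<open>f\<close> is not part of this locale: the lemmas below serve to correct
  an \<open>f\<close> that violates it.
\<close>

locale sl2_action = endo_space scale
  for scale :: "'k::field_char_0 \<Rightarrow> 'v::ab_group_add \<Rightarrow> 'v" (infixr "*s" 75) +
  fixes M :: "'v set" and e h f :: "'v \<Rightarrow> 'v" and n :: nat
  assumes M: "subspace M"
    and endo: "endo e" "endo h" "endo f"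
    and closed: "v \<in> M \<Longrightarrow> e v \<in> M" "v \<in> M \<Longrightarrow> h v \<in> M" "v \<in> M \<Longrightarrow> f v \<in> M"
    and he: "v \<in> M \<Longrightarrow> h (e v) = e (h v) + 2 *s e v"
    and ef: "v \<in> M \<Longrightarrow> e (f v) = f (e v) + h v"
    and nilp: "v \<in> M \<Longrightarrow> (e ^^ n) v = 0"
begin

lemma scale_2: "2 *s x = x + x" "(c * 2) *s x = c *s x + c *s x"
  by (metis one_add_one scale_left_distrib scale_one)
    (metis mult_2_right scale_left_distrib)

lemma power_closed: "v \<in> M \<Longrightarrow> (e ^^ k) v \<in> M"
  by (induction k) (auto intro: closed)

lemma M_closed:
  "x \<in> M \<Longrightarrow> y \<in> M \<Longrightarrow> x + y \<in> M" "x \<in> M \<Longrightarrow> y \<in> M \<Longrightarrow> x - y \<in> M" "x \<in> M \<Longrightarrow> c *s x \<in> M" "0 \<in> M"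
  using M by (auto simp: subspace_add subspace_diff subspace_scale subspace_0)

lemma power_h:
  assumes "v \<in> M"
  shows "h ((e ^^ k) v) = (e ^^ k) (h v + of_nat (2 * k) *s v)"
proof (induction k)
  case (Suc k)
  have "h ((e ^^ Suc k) v) = e (h ((e ^^ k) v)) + 2 *s e ((e ^^ k) v)"
    using he[OF power_closed[OF assms]] by simp
  also have "\<dots> = (e ^^ Suc k) (h v + of_nat (2 * k) *s v + 2 *s v)"
    by (simp add: Suc endo_simps[OF endo(1)] endo_simps[OF endo_power[OF endo(1)]])
  also have "h v + of_nat (2 * k) *s v + 2 *s v = h v + of_nat (2 * Suc k) *s v"
    by (simp add: scale_left_distrib add_ac)
  finally show ?case .
qed simp

text \<open>The commutator of \<open>e ^ (k + 1)\<close> with \<open>f\<close> in the enveloping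
  algebra of \<open>sl2\<close>; it follows from \<open>he\<close> and \<open>ef\<close>
  alone.\<close>

lemma power_f:
  assumes "v \<in> M"
  shows "(e ^^ Suc k) (f v) =
    f ((e ^^ Suc k) v) + of_nat (Suc k) *s (h ((e ^^ k) v) - of_nat k *s (e ^^ k) v)"
proof (induction k)
  case 0
  then show ?case using ef[OF assms] by simp
next
  case (Suc k)
  let ?v = "(e ^^ k) v"
  have v: "?v \<in> M" "e ?v \<in> M" using power_closed assms closed by auto
  have eh: "e (h ?v) = h (e ?v) - 2 *s e ?v" using he[OF v(1)] by simp
  have "(e ^^ Suc (Suc k)) (f v) = e ((e ^^ Suc k) (f v))" by simp
  also have "\<dots> = e (f (e ?v)) + of_nat (Suc k) *s (e (h ?v) - of_nat k *s e ?v)"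
    unfolding Suc by (simp add: endo_simps[OF endo(1)])
  also have "\<dots> = f (e (e ?v)) + (h (e ?v) + of_nat (Suc k) *s (h (e ?v) - 2 *s e ?v - of_nat k *s e ?v))"
    unfolding ef[OF v(2)] eh by (simp add: add_ac)
  also have "h (e ?v) + of_nat (Suc k) *s (h (e ?v) - 2 *s e ?v - of_nat k *s e ?v)
    = of_nat (Suc (Suc k)) *s (h (e ?v) - of_nat (Suc k) *s e ?v)"
    by (simp add: algebra_simps scale_2)
  finally show ?case by simp
qed

text \<open>Filter the kernel of \<open>e\<close> by the images of the powers of \<open>e\<close>:
  on layer \<open>k\<close>, \<open>h\<close> acts as \<open>k\<close> modulo the next layer, since
  by \<open>power_f\<close> the defect is \<open>(e ^^ Suc k) (f v)\<close> divided by
  \<open>k + 1\<close>.\<close>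

lemma primitive_step:
  assumes "v \<in> M" "e ((e ^^ k) v) = 0"
  obtains v' where "v' \<in> M" "h ((e ^^ k) v) - of_nat k *s (e ^^ k) v = (e ^^ Suc k) v'"
    "e ((e ^^ Suc k) v') = 0"
proof
  let ?u = "(e ^^ k) v" and ?v' = "(1 / of_nat (Suc k)) *s f v"
  show "?v' \<in> M" using assms by (intro M_closed closed)
  have "of_nat (Suc k) *s (h ?u - of_nat k *s ?u) = (e ^^ Suc k) (f v)"
    using power_f[OF assms(1), of k] assms(2) by (simp add: endo_0[OF endo(3)])
  then have "(1 / of_nat (Suc k)) *s (of_nat (Suc k) *s (h ?u - of_nat k *s ?u)) = (e ^^ Suc k) ?v'"
    by (simp only: endo_scale[OF endo_power[OF endo(1)]])
  then show *: "h ?u - of_nat k *s ?u = (e ^^ Suc k) ?v'"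
    by (simp del: funpow.simps of_nat_Suc)
  have "e (h ?u) = 0"
    using he[OF power_closed[OF assms(1), of k]] assms(2) endo_0[OF endo(2)] by (simp add: algebra_simps)
  then have "e (h ?u - of_nat k *s ?u) = 0"
    using assms(2) by (simp add: endo_simps[OF endo(1)])
  then show "e ((e ^^ Suc k) ?v') = 0" unfolding * .
qed

text \<open>On layer \<open>k\<close> of that filtration \<open>h + 2\<close> acts as
  \<open>k + 2\<close>, which is nonzero in characteristic \<open>0\<close>. Layer \<open>n\<close>
  is zero, and the induction descends from there.\<close>

lemma kernel_h_plus_2_surj:
  assumes "u \<in> M" "e u = 0"
  obtains w where "w \<in> M" "e w = 0" "u = h w + 2 *s w"
proof -
  have "\<exists>w\<in>M. e w = 0 \<and> (e ^^ k) v = h w + 2 *s w"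
    if "v \<in> M" "e ((e ^^ k) v) = 0" "k \<le> n" for k v
    using that(3,1,2)
  proof (induction k arbitrary: v rule: inc_induct)
    case base
    then show ?case
      using nilp M_closed(4) by (intro bexI[of _ 0]) (auto simp: endo_0[OF endo(1)] endo_0[OF endo(2)])
  next
    case (step k)
    let ?u = "(e ^^ k) v"
    obtain v' where v': "v' \<in> M" "h ?u - of_nat k *s ?u = (e ^^ Suc k) v'" "e ((e ^^ Suc k) v') = 0"
      using primitive_step step.prems by blast
    obtain w where w: "w \<in> M" "e w = 0" "(e ^^ Suc k) v' = h w + 2 *s w"
      using step.IH[OF v'(1,3)] by blast
    \<comment> \<open>\<open>(k + 2) u = (h + 2) u - (h - k) u\<close>, and the last term is
      \<open>(h + 2) w\<close>.\<close>
    let ?w = "(1 / of_nat (k + 2)) *s (?u - w)"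
    have nz: "(of_nat (k + 2) :: 'k) \<noteq> 0" by (simp only: of_nat_eq_0_iff)
    have "of_nat (k + 2) *s ?u = (h ?u + 2 *s ?u) - (h ?u - of_nat k *s ?u)"
      by (simp add: scale_left_distrib)
    also have "\<dots> = h (?u - w) + 2 *s (?u - w)"
      by (simp only: v'(2) w(3)) (simp add: endo_simps[OF endo(2)] scale_right_diff_distrib)
    finally have "(1 / of_nat (k + 2)) *s (of_nat (k + 2) *s ?u) =
        (1 / of_nat (k + 2)) *s (h (?u - w) + 2 *s (?u - w))" by simp
    then have "?u = h ?w + 2 *s ?w"
      using nz by (simp add: endo_scale[OF endo(2)] scale_right_distrib mult.commute del: of_nat_add)
    moreover have "?w \<in> M" using step.prems w by (intro M_closed power_closed)
    moreover have "e ?w = 0" using step.prems w by (simp add: endo_simps[OF endo(1)])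
    ultimately show ?case by blast
  qed
  from this[of u 0] show ?thesis using assms that by auto
qed

text \<open>If \<open>a\<close> differs from \<open>k\<close>, then \<open>(a - k) u\<close>, a
  nonzero multiple of \<open>u\<close>, lies one layer deeper. Layer \<open>n\<close> is zero, so
  \<open>a\<close> must equal some \<open>k\<close> on the way.\<close>

lemma primitive_eigenvalue:
  assumes "u \<in> M" "u \<noteq> 0" "e u = 0" "h u = a *s u"
  obtains m where "a = of_nat m"
proof -
  have "\<exists>m. a = of_nat m"
    if "v \<in> M" "e ((e ^^ k) v) = 0" "(e ^^ k) v \<noteq> 0" "h ((e ^^ k) v) = a *s (e ^^ k) v" "k \<le> n" for k v
    using that(5,1-4)
  proof (induction k arbitrary: v rule: inc_induct)
    case base
    then show ?case using nilp by simp
  next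
    case (step k)
    let ?u = "(e ^^ k) v"
    obtain v' where v': "v' \<in> M" "h ?u - of_nat k *s ?u = (e ^^ Suc k) v'" "e ((e ^^ Suc k) v') = 0"
      using primitive_step step.prems by blast
    then have eq: "(e ^^ Suc k) v' = (a - of_nat k) *s ?u"
      using step.prems(4) by (simp add: scale_left_diff_distrib)
    show ?case
    proof (cases "a = of_nat k")
      case False
      have "h ((e ^^ Suc k) v') = a *s (e ^^ Suc k) v'"
        unfolding eq using step.prems(4) by (simp add: endo_scale[OF endo(2)] mult.commute)
      with step.IH[OF v'(1,3)] False step.prems(3) eq show ?thesis by simp
    qed blast
  qed
  from this[of u 0] show ?thesis using assms that by auto
qed

text \<open>Dual to \<open>primitive_step\<close>: on the cokernel of \<open>e\<close>, filtered by
  the kernels of the powers of \<open>e\<close>, \<open>h\<close> acts as \<open>- k\<close> on the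
  layer of vectors killed by \<open>e ^ (k + 1)\<close>. Again \<open>f v\<close> divided by
  \<open>k + 1\<close> is the witness.\<close>

lemma cokernel_step:
  assumes "v \<in> M" "(e ^^ Suc k) v = 0"
  obtains w where "w \<in> M" "(e ^^ k) (h v + of_nat k *s v - e w) = 0"
proof
  let ?w = "(1 / of_nat (Suc k)) *s f v"
  show "?w \<in> M" using assms by (intro M_closed closed)
  note ek = endo_simps[OF endo_power[OF endo(1), of k]]
  have "of_nat (Suc k) *s (h ((e ^^ k) v) - of_nat k *s (e ^^ k) v) = (e ^^ Suc k) (f v)"
    using power_f[OF assms(1), of k] assms(2) by (simp add: endo_0[OF endo(3)] del: funpow.simps)
  also have "h ((e ^^ k) v) - of_nat k *s (e ^^ k) v = (e ^^ k) (h v + of_nat k *s v)"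
    unfolding power_h[OF assms(1)] by (simp add: ek algebra_simps scale_2)
  finally have "(1 / of_nat (Suc k)) *s (of_nat (Suc k) *s (e ^^ k) (h v + of_nat k *s v))
      = (1 / of_nat (Suc k)) *s (e ^^ Suc k) (f v)"
    by simp
  then have "(e ^^ k) (h v + of_nat k *s v) = (e ^^ Suc k) ?w"
    by (simp add: endo_scale[OF endo_power[OF endo(1), of "Suc k"]] del: of_nat_Suc funpow.simps)
  then show "(e ^^ k) (h v + of_nat k *s v - e ?w) = 0"
    by (simp add: ek funpow_Suc_right del: funpow.simps)
qed

text \<open>On layer \<open>k\<close> of the cokernel \<open>2 - h\<close> acts as
  \<open>k + 2\<close>, hence invertibly. In \<open>sl2_triple_lift\<close> this absorbs the error
  in the relation between \<open>H\<close> and \<open>E\<close>.\<close>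

lemma h_minus_2_e_surj:
  assumes "v \<in> M"
  obtains x y where "x \<in> M" "y \<in> M" "v = 2 *s y - h y + e x"
proof -
  have "\<exists>x\<in>M. \<exists>y\<in>M. v = 2 *s y - h y + e x" if "v \<in> M" "(e ^^ k) v = 0" for k v
    using that
  proof (induction k arbitrary: v)
    case 0
    then show ?case using M_closed(4) endo_0[OF endo(1)] endo_0[OF endo(2)]
      by (intro bexI[of _ 0]) auto
  next
    case (Suc k)
    obtain w where w: "w \<in> M" "(e ^^ k) (h v + of_nat k *s v - e w) = 0"
      using cokernel_step Suc.prems by blast
    have "h v + of_nat k *s v - e w \<in> M" using Suc.prems w by (intro M_closed closed)
    from Suc.IH[OF this w(2)] obtain x y where
      xy: "x \<in> M" "y \<in> M" "h v + of_nat k *s v - e w = 2 *s y - h y + e x" by blast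
    let ?c = "1 / of_nat (k + 2)"
    have nz: "(of_nat (k + 2) :: 'k) \<noteq> 0" by (simp only: of_nat_eq_0_iff)
    \<comment> \<open>\<open>(k + 2) v = (h + k) v + (2 - h) v\<close>, where the first term is
      covered by the induction hypothesis up to \<open>e w\<close>.\<close>
    have "of_nat (k + 2) *s v = (h v + of_nat k *s v - e w) + e w + (2 *s v - h v)"
      by (simp add: scale_left_distrib)
    also have "\<dots> = 2 *s (y + v) - h (y + v) + e (x + w)"
      unfolding xy(3) by (simp add: endo_simps[OF endo(1)] endo_simps[OF endo(2)] scale_right_distrib)
    finally have "?c *s (of_nat (k + 2) *s v) = ?c *s (2 *s (y + v) - h (y + v) + e (x + w))" by simp
    moreover have "?c *s (of_nat (k + 2) *s v) = v" using nz by (simp del: of_nat_add)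
    ultimately have "v = 2 *s (?c *s (y + v)) - h (?c *s (y + v)) + e (?c *s (x + w))"
      by (simp only: endo_scale[OF endo(2)] endo_scale[OF endo(1)] scale_right_distrib[of ?c "2 *s (y + v) - h (y + v)"]
          scale_right_diff_distrib[of ?c "2 *s (y + v)"] scale_scale mult.commute)
    moreover have "?c *s (y + v) \<in> M" "?c *s (x + w) \<in> M"
      using xy Suc.prems w by (auto intro!: M_closed)
    ultimately show ?case by blast
  qed
  then show ?thesis using assms nilp that by metis
qed

text \<open>The class of \<open>v\<close> in the cokernel of \<open>e\<close> is killed by
  \<open>h\<close>. Since \<open>h\<close> acts as \<open>- k\<close> on layer \<open>k\<close>, the
  class comes from the bottom layer, the kernel of \<open>e\<close>.\<close>

lemma weight_zero_decomposition:
  assumes "v \<in> M" "m \<in> M" "h v = e m"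
  obtains x w where "x \<in> M" "w \<in> M" "e x = 0" "v = x + e w"
proof -
  have "\<exists>x\<in>M. \<exists>w\<in>M. e x = 0 \<and> v = x + e w"
    if "v \<in> M" "(e ^^ k) v = 0" "m \<in> M" "h v = e m" for k v m
    using that
  proof (induction k arbitrary: v m)
    case 0
    then show ?case using M_closed(4) endo_0[OF endo(1)]
      by (intro bexI[of _ 0]) auto
  next
    case (Suc k)
    show ?case
    proof (cases "k = 0")
      case True
      then show ?thesis using Suc.prems M_closed(4) endo_0[OF endo(1)]
        by (intro bexI[of _ v] bexI[of _ 0]) auto
    next
      case False
      obtain u where u: "u \<in> M" "(e ^^ k) (h v + of_nat k *s v - e u) = 0"
        using cokernel_step Suc.prems by blast
      let ?v = "h v + of_nat k *s v - e u"
      have v: "?v \<in> M" "m - u \<in> M" using Suc.prems u by (auto intro: M_closed closed)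
      \<comment> \<open>As \<open>h v = e m\<close>, modulo the image of \<open>e\<close> the vector
        \<open>?v\<close> is just \<open>k\<close> times \<open>v\<close>; a decomposition of
        \<open>?v\<close> gives one of \<open>v\<close> after division by \<open>k\<close>.\<close>
      have v_eq: "?v = of_nat k *s v + e (m - u)"
        using Suc.prems by (simp add: endo_simps[OF endo(1)])
      have "h ?v = h (of_nat k *s v + e (m - u))"
        by (rule arg_cong[OF v_eq])
      also have "\<dots> = e (of_nat k *s m + (h (m - u) + 2 *s (m - u)))"
        by (simp only: he[OF v(2)] Suc.prems(4) endo_add[OF endo(2)] endo_scale[OF endo(2)]
            endo_add[OF endo(1)] endo_scale[OF endo(1)])
      finally have "h ?v = e (of_nat k *s m + (h (m - u) + 2 *s (m - u)))" .
      moreover have "of_nat k *s m + (h (m - u) + 2 *s (m - u)) \<in> M"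
        using Suc.prems v u by (intro M_closed closed)
      ultimately obtain x w where xw: "x \<in> M" "w \<in> M" "e x = 0" "?v = x + e w"
        using Suc.IH[OF v(1) u(2)] by blast
      let ?c = "1 / of_nat k"
      have "of_nat k *s v = x + e (w - (m - u))"
        using xw(4) v_eq by (simp add: endo_simps[OF endo(1)] algebra_simps)
      then have "?c *s (of_nat k *s v) = ?c *s (x + e (w - (m - u)))" by simp
      then have "v = ?c *s x + e (?c *s (w - (m - u)))"
        using False by (simp add: endo_scale[OF endo(1)] scale_right_distrib)
      moreover have "?c *s x \<in> M" "?c *s (w - (m - u)) \<in> M" "e (?c *s x) = 0"
        using xw v by (simp_all add: M_closed endo_scale[OF endo(1)])
      ultimately show ?thesis by blast
    qed
  qed
  then show ?thesis using assms nilp that by metis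
qed

end

section \<open>Ideals, Engel's theorem and the Killing form\<close>

locale fd_lie_algebra = lie_algebra scale bracket + fd_endo_space scale Basis
  for scale :: "'k::field \<Rightarrow> 'v::ab_group_add \<Rightarrow> 'v" (infixr "*s" 75)
    and bracket :: "'v \<Rightarrow> 'v \<Rightarrow> 'v" ("\<langle>_, _\<rangle>")
    and Basis
begin

lemma endo_ad: "endo (bracket X)"
  using linear_bracket_right .

lemma endo_bracket_left: "endo (\<lambda>X. \<langle>X, Y\<rangle>)"
  using linear_bracket_left .

lemmas bracket_right = endo_simps[OF endo_ad]
lemmas bracket_left = endo_simps[OF endo_bracket_left]
lemmas bracket_simps = bracket_right bracket_left bracket_self

lemma bracket_anticommute: "\<langle>X, Y\<rangle> = - \<langle>Y, X\<rangle>"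
proof -
  have "\<langle>X + Y, X + Y\<rangle> = \<langle>X, X\<rangle> + \<langle>Y, X\<rangle> + (\<langle>X, Y\<rangle> + \<langle>Y, Y\<rangle>)"
    by (simp only: bracket_right(1) bracket_left(1))
  then show ?thesis by (simp add: bracket_self eq_neg_iff_add_eq_0 add.commute)
qed

lemma bracket_bracket_right: "\<langle>X, \<langle>Y, Z\<rangle>\<rangle> = \<langle>\<langle>X, Y\<rangle>, Z\<rangle> + \<langle>Y, \<langle>X, Z\<rangle>\<rangle>"
proof -
  have "\<langle>Z, \<langle>X, Y\<rangle>\<rangle> = - \<langle>\<langle>X, Y\<rangle>, Z\<rangle>" "\<langle>Y, \<langle>Z, X\<rangle>\<rangle> = - \<langle>Y, \<langle>X, Z\<rangle>\<rangle>"
    using bracket_anticommute by (metis, metis bracket_right(4))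
  then show ?thesis
    using jacobi[of X Y Z] by (simp add: algebra_simps)
qed

lemma bracket_bracket_left: "\<langle>\<langle>X, Y\<rangle>, Z\<rangle> = \<langle>X, \<langle>Y, Z\<rangle>\<rangle> - \<langle>Y, \<langle>X, Z\<rangle>\<rangle>"
  using bracket_bracket_right[of X Y Z] by simp

section \<open>Ideals and Engel's theorem\<close>

definition bracket_span :: "'v set \<Rightarrow> 'v set \<Rightarrow> 'v set" where
  "bracket_span S T = span {\<langle>X, Y\<rangle> | X Y. X \<in> S \<and> Y \<in> T}"

lemma bracket_in_bracket_span: "X \<in> S \<Longrightarrow> Y \<in> T \<Longrightarrow> \<langle>X, Y\<rangle> \<in> bracket_span S T"
  unfolding bracket_span_def by (intro span_base) blast

lemma bracket_span_subset:
  assumes "\<And>X Y. X \<in> S \<Longrightarrow> Y \<in> T \<Longrightarrow> \<langle>X, Y\<rangle> \<in> U" "subspace U"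
  shows "bracket_span S T \<subseteq> U"
  unfolding bracket_span_def using assms by (intro span_minimal) auto

lemma derived_series_Suc: "derived_series (Suc n) = bracket_span (derived_series n) (derived_series n)"
  by (simp add: bracket_span_def)

abbreviation derived_algebra :: "'v set" where
  "derived_algebra \<equiv> bracket_span UNIV UNIV"

definition ideal :: "'v set \<Rightarrow> bool" where
  "ideal I \<longleftrightarrow> subspace I \<and> (\<forall>X. \<forall>Y\<in>I. \<langle>X, Y\<rangle> \<in> I)"

definition abelian :: "'v set \<Rightarrow> bool" where
  "abelian S \<longleftrightarrow> (\<forall>X\<in>S. \<forall>Y\<in>S. \<langle>X, Y\<rangle> = 0)"

lemma idealD:
  assumes "ideal I"
  shows "subspace I" "Y \<in> I \<Longrightarrow> \<langle>X, Y\<rangle> \<in> I" "Y \<in> I \<Longrightarrow> \<langle>Y, X\<rangle> \<in> I"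
  using assms bracket_anticommute[of Y X] by (auto simp: ideal_def subspace_neg)

lemma ideal_bracket_span:
  assumes "ideal I" "ideal J"
  shows "ideal (bracket_span I J)"
  unfolding ideal_def
proof safe
  show sub: "subspace (bracket_span I J)" by (simp add: bracket_span_def)
  fix X Y assume Y: "Y \<in> bracket_span I J"
  have "bracket_span I J \<subseteq> {Y. \<langle>X, Y\<rangle> \<in> bracket_span I J}"
  proof (rule bracket_span_subset)
    fix A B assume "A \<in> I" "B \<in> J"
    then show "\<langle>A, B\<rangle> \<in> {Y. \<langle>X, Y\<rangle> \<in> bracket_span I J}"
      using idealD(2)[OF assms(1), of A X] idealD(2)[OF assms(2), of B X]
      by (simp add: bracket_bracket_right[of X A B] bracket_in_bracket_span subspace_add[OF sub])
  next
    show "subspace {Y. \<langle>X, Y\<rangle> \<in> bracket_span I J}"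
      using sub by (auto simp: subspace_def bracket_simps)
  qed
  with Y show "\<langle>X, Y\<rangle> \<in> bracket_span I J" by auto
qed

lemma ideal_UNIV: "ideal UNIV"
  by (simp add: ideal_def)

lemma ideal_Int: "ideal I \<Longrightarrow> ideal J \<Longrightarrow> ideal (I \<inter> J)"
  by (simp add: ideal_def subspace_inter)

text \<open>The pair \<open>W'\<close>, \<open>W\<close> encodes the action on a quotient, so that
  one induction hypothesis serves twice: for a maximal proper subalgebra \<open>M\<close> acting on
  \<open>L / M\<close>, and for \<open>M\<close> acting on \<open>W / W'\<close>.\<close>

lemma engel:
  assumes "subspace L" "\<And>x y. x \<in> L \<Longrightarrow> y \<in> L \<Longrightarrow> \<langle>x, y\<rangle> \<in> L"
    and "\<And>x. x \<in> L \<Longrightarrow> \<exists>k. \<forall>v. (bracket x ^^ k) v = 0"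
    and "subspace W" "subspace W'" "W' \<subset> W"
    and "\<And>x w. x \<in> L \<Longrightarrow> w \<in> W \<Longrightarrow> \<langle>x, w\<rangle> \<in> W" "\<And>x w. x \<in> L \<Longrightarrow> w \<in> W' \<Longrightarrow> \<langle>x, w\<rangle> \<in> W'"
  shows "\<exists>v\<in>W - W'. \<forall>x\<in>L. \<langle>x, v\<rangle> \<in> W'"
  using assms
proof (induction "dim L" arbitrary: L W W' rule: less_induct)
  case less
  note L = less.prems
  show ?case
  proof (cases "L = {0}")
    case True
    obtain v where "v \<in> W - W'" using L(6) by blast
    moreover have "0 \<in> W'" using L(5) by (rule subspace_0)
    ultimately show ?thesis using True by (intro bexI[of _ v]) (simp_all add: bracket_left)
  next
    case False
    let ?sub = "\<lambda>M. subspace M \<and> (\<forall>x\<in>M. \<forall>y\<in>M. \<langle>x, y\<rangle> \<in> M) \<and> M \<subset> L"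
    have "?sub {0}" using False subspace_0[OF L(1)] by (auto simp: bracket_simps)
    moreover have "\<forall>M. ?sub M \<longrightarrow> dim M < Suc (dim L)"
      using dim_subset less_Suc_eq_le psubset_imp_subset by blast
    ultimately have "\<exists>M. ?sub M \<and> (\<forall>M'. ?sub M' \<longrightarrow> dim M' \<le> dim M)"
      by (rule ex_has_greatest_nat)
    then obtain M where M: "?sub M" "\<And>M'. ?sub M' \<Longrightarrow> dim M' \<le> dim M" by blast
    have "dim M < dim L"
      using M(1) L(1) by (intro dim_psubset) (auto simp: span_eq_iff[THEN iffD2])
    note IH = less.hyps[OF this]
    have "\<exists>y\<in>L - M. \<forall>x\<in>M. \<langle>x, y\<rangle> \<in> M"
      using M(1) L by (intro IH) auto
    then obtain y where y: "y \<in> L" "y \<notin> M" "\<And>x. x \<in> M \<Longrightarrow> \<langle>x, y\<rangle> \<in> M" by blast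
    let ?M = "span (insert y M)"
    have elem: "z \<in> ?M \<longleftrightarrow> (\<exists>c. z - c *s y \<in> M)" for z
      using M(1) by (simp add: span_insert span_eq_iff[THEN iffD2])
    \<comment> \<open>\<open>y\<close> normalizes \<open>M\<close>, so both together span a
      subalgebra, which by maximality of \<open>M\<close> is \<open>L\<close>.\<close>
    have "?M = L"
    proof (rule ccontr)
      assume ne: "?M \<noteq> L"
      have "?M \<subseteq> L" using y M(1) L(1) by (intro span_minimal) auto
      with ne have "?M \<subset> L" by blast
      moreover have "\<langle>u, v\<rangle> \<in> ?M" if uv: "u \<in> ?M" "v \<in> ?M" for u v
      proof -
        obtain c d where cd: "u - c *s y \<in> M" "v - d *s y \<in> M" using uv elem by blast
        have "\<langle>u, v\<rangle> = \<langle>u - c *s y, v - d *s y\<rangle> + d *s \<langle>u - c *s y, y\<rangle> - c *s \<langle>v - d *s y, y\<rangle>"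
          using bracket_anticommute[of y v]
          by (simp add: bracket_simps scale_right_diff_distrib)
        also have "\<dots> \<in> M"
          using cd y M(1) by (intro subspace_diff subspace_add subspace_scale) auto
        finally show ?thesis by (intro span_base) auto
      qed
      ultimately have "dim ?M \<le> dim M" by (intro M(2)) auto
      moreover have "dim ?M = dim M + 1"
        using y M(1) by (simp add: dim_insert span_eq_iff[THEN iffD2])
      ultimately show False by simp
    qed
    have "\<exists>u\<in>W - W'. \<forall>x\<in>M. \<langle>x, u\<rangle> \<in> W'"
      using M(1) L by (intro IH) auto
    then obtain u where u: "u \<in> W" "u \<notin> W'" "\<And>x. x \<in> M \<Longrightarrow> \<langle>x, u\<rangle> \<in> W'" by blast
    obtain k where k: "\<And>v. (bracket y ^^ k) v = 0" using L(3) y(1) by blast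
    have pow: "(bracket y ^^ j) u \<in> W \<and> (\<forall>x\<in>M. \<langle>x, (bracket y ^^ j) u\<rangle> \<in> W')" for j
    proof (induction j)
      case 0
      then show ?case using u by simp
    next
      case (Suc j)
      let ?v = "(bracket y ^^ j) u"
      have "\<langle>x, \<langle>y, ?v\<rangle>\<rangle> \<in> W'" if "x \<in> M" for x
        unfolding bracket_bracket_right[of x]
        using Suc y that L(5,8) by (intro subspace_add) auto
      then show ?case using Suc y(1) L(7) by auto
    qed
    \<comment> \<open>All vectors \<open>(bracket y ^^ j) u\<close> are annihilated by
      \<open>M\<close> modulo \<open>W'\<close>; the one just before \<open>W'\<close> is first
      reached is annihilated by \<open>y\<close> as well.\<close>
    define j where "j = (LEAST j. (bracket y ^^ j) u \<in> W')"
    have "(bracket y ^^ k) u \<in> W'" using k L(5) subspace_0 by simp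
    then have j: "(bracket y ^^ j) u \<in> W'" unfolding j_def by (rule LeastI)
    then obtain i where i: "j = Suc i" using u(2) by (cases j) auto
    let ?v = "(bracket y ^^ i) u"
    have "?v \<notin> W'" using not_less_Least[of i "\<lambda>j. (bracket y ^^ j) u \<in> W'"] i j_def by simp
    moreover have "\<langle>x, ?v\<rangle> \<in> W'" if x: "x \<in> L" for x
    proof -
      obtain c where c: "x - c *s y \<in> M" using x elem \<open>?M = L\<close> by blast
      have "\<langle>x, ?v\<rangle> = \<langle>x - c *s y, ?v\<rangle> + c *s \<langle>y, ?v\<rangle>" by (simp add: bracket_simps)
      also have "\<dots> \<in> W'"
        using pow c j i L(5) by (intro subspace_add subspace_scale) auto
      finally show ?thesis .
    qed
    ultimately show ?thesis using pow by blast
  qed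
qed

text \<open>The center of \<open>J\<close> is abelian and an ideal of the whole algebra; Engel's
  theorem for \<open>J\<close> acting on itself makes it nonzero.\<close>

lemma nil_ideal_contains_abelian_ideal:
  assumes "ideal J" "J \<noteq> {0}" "\<And>x. x \<in> J \<Longrightarrow> \<exists>k. \<forall>v. (bracket x ^^ k) v = 0"
  obtains A where "ideal A" "abelian A" "A \<subseteq> J" "A \<noteq> {0}"
proof -
  note J = idealD[OF assms(1)]
  have "{0} \<subset> J" using assms(2) subspace_0[OF J(1)] by auto
  then have "\<exists>v\<in>J - {0}. \<forall>x\<in>J. \<langle>x, v\<rangle> \<in> {0}"
    using J assms(3) by (intro engel) (auto simp: bracket_simps)
  then obtain v where v: "v \<in> J" "v \<noteq> 0" "\<forall>x\<in>J. \<langle>x, v\<rangle> = 0" by auto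
  let ?A = "{v \<in> J. \<forall>x\<in>J. \<langle>x, v\<rangle> = 0}"
  have "ideal ?A"
    unfolding ideal_def
  proof safe
    show "subspace ?A" using J(1) by (auto simp: subspace_def bracket_simps)
  next
    fix X v assume v: "v \<in> J" "\<forall>x\<in>J. \<langle>x, v\<rangle> = 0"
    then show "\<langle>X, v\<rangle> \<in> J" using J(2) by blast
    fix x assume "x \<in> J"
    with v J(3) show "\<langle>x, \<langle>X, v\<rangle>\<rangle> = 0"
      by (simp add: bracket_bracket_right[of x X v] bracket_simps)
  qed
  moreover have "abelian ?A" by (auto simp: abelian_def)
  ultimately show ?thesis using that[of ?A] v by blast
qed

section \<open>The Killing form and its radical\<close>

definition killing :: "'v \<Rightarrow> 'v \<Rightarrow> 'k" where
  "killing X Y = trace Basis (\<lambda>v. \<langle>X, \<langle>Y, v\<rangle>\<rangle>)"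

lemmas trace_Basis_lin = trace_lin[OF independent_Basis span_Basis]
lemmas trace_Basis_commute = trace_commute[OF independent_Basis span_Basis]

lemma killing_lin:
  "killing (X + X') Y = killing X Y + killing X' Y"
  "killing X (Y + Y') = killing X Y + killing X Y'"
  "killing (X - X') Y = killing X Y - killing X' Y"
  "killing X (Y - Y') = killing X Y - killing X Y'"
  "killing (c *s X) Y = c * killing X Y"
  "killing X (c *s Y) = c * killing X Y"
  by (simp_all add: killing_def bracket_simps trace_Basis_lin)

lemma killing_minus: "killing (- X) Y = - killing X Y" "killing X (- Y) = - killing X Y"
  using killing_lin(5,6)[where c = "-1"] by simp_all

lemma killing_commute: "killing X Y = killing Y X"
  unfolding killing_def by (rule trace_Basis_commute[OF endo_ad endo_ad])

lemma killing_invariant: "killing \<langle>X, Y\<rangle> Z = killing X \<langle>Y, Z\<rangle>"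
proof -
  have "trace Basis (\<lambda>v. \<langle>Y, \<langle>X, \<langle>Z, v\<rangle>\<rangle>\<rangle>) = trace Basis (\<lambda>v. \<langle>X, \<langle>Z, \<langle>Y, v\<rangle>\<rangle>\<rangle>)"
    by (rule trace_Basis_commute[OF endo_ad endo_compose[OF endo_ad endo_ad]])
  then show ?thesis
    by (simp add: killing_def bracket_bracket_left bracket_simps trace_Basis_lin)
qed

lemma linear_killing: "Vector_Spaces.linear scale (*) (killing X)"
  using vector_space_axioms
  by (simp add: Vector_Spaces.linear_iff killing_lin vector_space_def algebra_simps)

lemma killing_form: "linear_to_dual killing" "ad_invariant killing" "symmetric killing"
proof -
  have "killing = (\<lambda>Y X. killing X Y)" by (intro ext) (rule killing_commute)
  then have "(\<lambda>X. killing X Y) = killing Y" for Y by metis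
  then show "linear_to_dual killing" by (simp add: linear_to_dual_def linear_killing)
  show "ad_invariant killing"
    by (metis ad_invariant_def killing_invariant killing_minus(1) bracket_anticommute)
  show "symmetric killing"
    by (auto simp: symmetric_def dual_transpose_def killing_commute)
qed

definition killing_radical :: "'v set" where
  "killing_radical = {X. \<forall>Y. killing X Y = 0}"

lemma killing_radicalD: "X \<in> killing_radical \<Longrightarrow> killing X Y = 0"
  by (simp add: killing_radical_def)

lemma ideal_killing_radical: "ideal killing_radical"
  unfolding ideal_def
proof safe
  show "subspace killing_radical"
    using killing_lin(5)[where c = 0] by (simp add: subspace_def killing_radical_def killing_lin)
  fix X Y assume "Y \<in> killing_radical"
  then have "killing \<langle>Y, X\<rangle> Z = 0" for Z
    by (simp add: killing_invariant killing_radicalD)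
  then show "\<langle>X, Y\<rangle> \<in> killing_radical"
    by (simp add: killing_radical_def bracket_anticommute[of X Y] killing_minus)
qed

text \<open>The radical is the common kernel of the functionals \<open>killing b\<close> with
  \<open>b\<close> in \<open>Basis\<close>, so \<open>f\<close> is a combination of them.\<close>

lemma killing_represents:
  assumes "Vector_Spaces.linear scale (*) f" "\<And>X. X \<in> killing_radical \<Longrightarrow> f X = 0"
  obtains W where "\<And>X. f X = killing W X"
proof -
  have "\<exists>c. \<forall>v. f v = (\<Sum>g\<in>killing ` Basis. c g * g v)"
  proof (rule functional_eq_combination)
    fix X assume X: "\<And>g. g \<in> killing ` Basis \<Longrightarrow> g X = 0"
    have "span Basis \<subseteq> {Y. killing X Y = 0}"
    proof (rule span_minimal)
      show "Basis \<subseteq> {Y. killing X Y = 0}" using X killing_commute by auto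
      show "subspace {Y. killing X Y = 0}"
        using killing_lin(6)[where c = 0] by (simp add: subspace_def killing_lin)
    qed
    then have "X \<in> killing_radical" by (auto simp: span_Basis killing_radical_def)
    then show "f X = 0" by (rule assms(2))
  qed (use assms(1) linear_killing finite_Basis in auto)
  then obtain c where c: "\<And>v. f v = (\<Sum>g\<in>killing ` Basis. c g * g v)" by blast
  \<comment> \<open>Different basis vectors may give the same functional, so a representative is
    chosen for each functional.\<close>
  have "\<forall>g\<in>killing ` Basis. \<exists>W. killing W = g" by blast
  then obtain r where r: "\<And>g. g \<in> killing ` Basis \<Longrightarrow> killing (r g) = g"
    using bchoice by metis
  have sum: "killing (\<Sum>g\<in>S. h g) X = (\<Sum>g\<in>S. killing (h g) X)" for S and h :: "_ \<Rightarrow> 'v" and X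
    using killing_lin(5)[where c = 0] by (induction S rule: infinite_finite_induct) (simp_all add: killing_lin)
  have "f X = killing (\<Sum>g\<in>killing ` Basis. c g *s r g) X" for X
    unfolding c sum by (simp add: killing_lin r)
  then show ?thesis using that by blast
qed

lemma separating_functional:
  assumes "subspace S" "E \<notin> S"
  obtains f where "Vector_Spaces.linear scale (*) f" "\<And>X. X \<in> S \<Longrightarrow> f X = 0" "f E = 1"
proof -
  obtain P where P: "endo P" "\<And>v. P v = 0 \<longleftrightarrow> v \<in> S"
    using subspace_projection[OF assms(1)] by metis
  let ?C = "extend_basis {P E}"
  have "independent {P E}" using P assms(2) by simp
  then have C: "independent ?C" "P E \<in> ?C" "span ?C = UNIV"
    using independent_extend_basis extend_basis_superset span_extend_basis by blast+
  let ?f = "\<lambda>v. representation ?C (P v) (P E)"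
  have "Vector_Spaces.linear scale (*) ?f"
    using linear_representation[OF C(1,3)] vector_space_axioms
    by (simp add: Vector_Spaces.linear_iff endo_simps[OF P(1)] vector_space_def algebra_simps)
  moreover have "?f X = 0" if "X \<in> S" for X
    using that P(2)[of X] by (simp add: representation_zero)
  moreover have "?f E = 1" using C by (simp add: representation_basis)
  ultimately show ?thesis using that by blast
qed

lemma Tstar_solitary_killing:
  assumes Tstar_solitary
  obtains D where "dual_derivation D" "\<And>X Y. killing X Y = D X Y + D Y X"
proof -
  obtain D where "dual_derivation D" "killing = (\<lambda>X Y. D X Y + dual_transpose D X Y)"
    using assms killing_form unfolding Tstar_solitary_def by blast
  then show ?thesis using that by (simp add: dual_transpose_def)
qed

end

section \<open>Complex Lie algebras and \<open>sl2\<close>-triples\<close>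

locale complex_lie_algebra = fd_lie_algebra scale bracket Basis + complex_endo_space scale Basis
  for scale :: "complex \<Rightarrow> 'v::ab_group_add \<Rightarrow> 'v" (infixr "*s" 75)
    and bracket :: "'v \<Rightarrow> 'v \<Rightarrow> 'v" ("\<langle>_, _\<rangle>")
    and Basis
begin

section \<open>Cartan's criterion for the Killing radical\<close>

lemma gen_eigenspace_ad_bracket:
  assumes "u \<in> gen_eigenspace (bracket X) a" "v \<in> gen_eigenspace (bracket X) b"
  shows "\<langle>u, v\<rangle> \<in> gen_eigenspace (bracket X) (a + b)"
proof -
  note sub = subspace_gen_eigenspace[OF endo_ad]
  \<comment> \<open>\<open>ad X - (a + b)\<close> obeys a Leibniz rule with \<open>ad X - a\<close>
    on \<open>u\<close> and \<open>ad X - b\<close> on \<open>v\<close>. The quantifier over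
    \<open>v\<close> makes the hypothesis for \<open>u\<close> available in the inner
    induction.\<close>
  have "\<forall>v\<in>gen_eigenspace (bracket X) b. \<langle>u, v\<rangle> \<in> gen_eigenspace (bracket X) (a + b)"
    using endo_ad assms(1)
  proof (induction rule: gen_eigenspace_induct)
    case zero
    then show ?case using subspace_0[OF sub] by (simp add: bracket_simps)
  next
    case (step u)
    show ?case
    proof
      fix v assume "v \<in> gen_eigenspace (bracket X) b"
      with endo_ad show "\<langle>u, v\<rangle> \<in> gen_eigenspace (bracket X) (a + b)"
      proof (induction rule: gen_eigenspace_induct)
        case zero
        then show ?case using subspace_0[OF sub] by (simp add: bracket_simps)
      next
        case v: (step v)
        have "\<langle>X, \<langle>u, v\<rangle>\<rangle> - (a + b) *s \<langle>u, v\<rangle> = \<langle>\<langle>X, u\<rangle> - a *s u, v\<rangle> + \<langle>u, \<langle>X, v\<rangle> - b *s v\<rangle>"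
          by (simp add: bracket_bracket_right[of X u v] bracket_simps scale_left_distrib)
        also have "\<dots> \<in> gen_eigenspace (bracket X) (a + b)"
          using step.IH v by (intro subspace_add[OF sub]) auto
        finally show ?case by (rule gen_eigenspace_stepD)
      qed
    qed
  qed
  with assms(2) show ?thesis by blast
qed

text \<open>\<open>s\<close> is the complex conjugate of the semisimple part of \<open>ad X\<close>.
  It is a derivation because eigenvalues add under the bracket and conjugation is additive.\<close>

lemma conjugate_semisimple_part:
  obtains s where "endo s" "\<And>u v. s \<langle>u, v\<rangle> = \<langle>s u, v\<rangle> + \<langle>u, s v\<rangle>"
    "\<And>a v. v \<in> gen_eigenspace (bracket X) a \<Longrightarrow> s v = cnj a *s v"
proof -
  obtain B ev where B: "independent B" "span B = UNIV" "\<And>b. b \<in> B \<Longrightarrow> b \<in> gen_eigenspace (bracket X) (ev b)"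
    using gen_eigenbasis_exists[OF endo_ad] by blast
  obtain s where s: "endo s" "\<And>a v. v \<in> gen_eigenspace (bracket X) a \<Longrightarrow> s v = cnj a *s v"
    using spectral_endo[OF endo_ad B] by blast
  have 1: "s \<langle>b, b'\<rangle> = \<langle>s b, b'\<rangle> + \<langle>b, s b'\<rangle>" if "b \<in> B" "b' \<in> B" for b b'
    using s(2)[OF gen_eigenspace_ad_bracket[OF B(3)[OF that(1)] B(3)[OF that(2)]]] s(2)[OF B(3)] that
    by (simp add: bracket_simps scale_left_distrib)
  have 2: "s \<langle>b, v\<rangle> = \<langle>s b, v\<rangle> + \<langle>b, s v\<rangle>" if "b \<in> B" for b v
    by (rule endo_eq_on_span[OF endo_compose[OF s(1) endo_ad]
          endo_plus[OF endo_ad endo_compose[OF endo_ad s(1)]], of B]) (use 1 that B in auto)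
  have "s \<langle>u, v\<rangle> = \<langle>s u, v\<rangle> + \<langle>u, s v\<rangle>" for u v
    by (rule endo_eq_on_span[OF endo_compose[OF s(1) endo_bracket_left]
          endo_plus[OF endo_compose[OF endo_bracket_left s(1)] endo_bracket_left], of B]) (use 2 B in auto)
  with s show ?thesis using that by blast
qed

text \<open>For a derivation \<open>s\<close>, cyclicity of the trace gives
  \<open>tr (ad [A, B] s) = - killing A (s B)\<close>, which vanishes for \<open>A\<close> in the
  radical.\<close>

lemma trace_ad_derivation:
  assumes "endo s" "\<And>u v. s \<langle>u, v\<rangle> = \<langle>s u, v\<rangle> + \<langle>u, s v\<rangle>"
    and "X \<in> bracket_span killing_radical killing_radical"
  shows "trace Basis (\<lambda>v. \<langle>X, s v\<rangle>) = 0"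
proof -
  have "bracket_span killing_radical killing_radical \<subseteq> {X. trace Basis (\<lambda>v. \<langle>X, s v\<rangle>) = 0}"
  proof (rule bracket_span_subset)
    fix A B assume A: "A \<in> killing_radical"
    have "trace Basis (\<lambda>v. \<langle>B, \<langle>A, s v\<rangle>\<rangle>) = trace Basis (\<lambda>v. \<langle>A, s \<langle>B, v\<rangle>\<rangle>)"
      by (rule trace_Basis_commute[OF endo_ad endo_compose[OF endo_ad assms(1)]])
    then have "trace Basis (\<lambda>v. \<langle>\<langle>A, B\<rangle>, s v\<rangle>) = - killing A (s B)"
      by (simp add: killing_def bracket_bracket_left assms(2) bracket_simps trace_Basis_lin)
    then show "\<langle>A, B\<rangle> \<in> {X. trace Basis (\<lambda>v. \<langle>X, s v\<rangle>) = 0}"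
      using killing_radicalD[OF A] by simp
  next
    show "subspace {X. trace Basis (\<lambda>v. \<langle>X, s v\<rangle>) = 0}"
      using trace_Basis_lin(3)[of 0 "\<lambda>v. v"] by (simp add: subspace_def bracket_simps trace_Basis_lin)
  qed
  with assms(3) show ?thesis by auto
qed

text \<open>
  Pairing \<open>ad X\<close> with the complex conjugate of its semisimple part turns the trace into the sum of the
  squared moduli of the eigenvalues of \<open>ad X\<close>.
\<close>

lemma nilpotent_if_in_radical_bracket:
  assumes X: "X \<in> bracket_span killing_radical killing_radical"
  obtains n where "\<And>v. (bracket X ^^ n) v = 0"
proof -
  obtain B ev where B: "independent B" "span B = UNIV" "\<And>b. b \<in> B \<Longrightarrow> b \<in> gen_eigenspace (bracket X) (ev b)"
    using gen_eigenbasis_exists[OF endo_ad] by blast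
  obtain s where s: "endo s" "\<And>u v. s \<langle>u, v\<rangle> = \<langle>s u, v\<rangle> + \<langle>u, s v\<rangle>"
    "\<And>a v. v \<in> gen_eigenspace (bracket X) a \<Longrightarrow> s v = cnj a *s v"
    using conjugate_semisimple_part[of X] by blast
  let ?m = "\<lambda>v. \<langle>X, s v\<rangle>"
  have m: "endo ?m" by (rule endo_compose[OF endo_ad s(1)])
  note sub = subspace_gen_eigenspace[OF endo_ad]
  have "trace Basis ?m = (\<Sum>b\<in>B. ev b * cnj (ev b))"
  proof (rule trace_eq_sum_eigenvalues[OF endo_ad B independent_Basis span_Basis m])
    fix a v assume v: "v \<in> gen_eigenspace (bracket X) a"
    then show "?m v \<in> gen_eigenspace (bracket X) a"
      using gen_eigenspace_commute[OF endo_ad endo_ad] by (simp add: s(3) bracket_simps subspace_scale[OF sub])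
    from endo_ad v show "v \<in> gen_eigenspace ?m (a * cnj a)"
    proof (induction rule: gen_eigenspace_induct)
      case zero
      then show ?case by (rule subspace_0[OF subspace_gen_eigenspace[OF m]])
    next
      case (step v)
      have "?m v - (a * cnj a) *s v = cnj a *s (\<langle>X, v\<rangle> - a *s v)"
        by (simp add: s(3)[OF step.hyps] bracket_simps scale_right_diff_distrib mult.commute)
      also have "\<dots> \<in> gen_eigenspace ?m (a * cnj a)"
        using step.IH by (rule subspace_scale[OF subspace_gen_eigenspace[OF m]])
      finally show ?case by (rule gen_eigenspace_stepD)
    qed
  qed
  moreover have "trace Basis ?m = 0" by (rule trace_ad_derivation[OF s(1,2) X])
  ultimately have "(\<Sum>b\<in>B. of_real ((norm (ev b))\<^sup>2)) = (0::complex)"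
    by (simp only: complex_norm_square)
  then have "(\<Sum>b\<in>B. (norm (ev b))\<^sup>2) = 0" by (simp only: of_real_sum[symmetric] of_real_eq_0_iff)
  then have "\<forall>b\<in>B. (norm (ev b))\<^sup>2 = 0"
    using B(1) finiteI_independent by (subst (asm) sum_nonneg_eq_0_iff) auto
  then have ev: "ev b = 0" if "b \<in> B" for b using that by auto
  show ?thesis
  proof (rule nilpotent_if_locally_nilpotent[OF endo_ad B(2)])
    fix b assume "b \<in> B"
    then show "\<exists>k. (bracket X ^^ k) b = 0"
      using B(3)[of b] ev[of b] by (auto simp: gen_eigenspace_def)
  qed (use that in blast)
qed

text \<open>The error \<open>[H, Z] + 2 Z\<close> lies in the kernel of \<open>ad E\<close>. There
  \<open>ad H + 2\<close> is onto, so the same error is produced by some \<open>W\<close> in the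
  kernel, and \<open>Z - W\<close> has none.\<close>

lemma jacobson_morozov:
  assumes HE: "\<langle>H, E\<rangle> = 2 *s E" and EZ: "\<langle>E, Z\<rangle> = H"
  obtains F where "\<langle>E, F\<rangle> = H" "\<langle>H, F\<rangle> = - (2 *s F)"
proof -
  have rel: "\<langle>H, \<langle>E, v\<rangle>\<rangle> = \<langle>E, \<langle>H, v\<rangle>\<rangle> + 2 *s \<langle>E, v\<rangle>" for v
    by (simp add: bracket_bracket_right[of H E v] HE bracket_simps)
  obtain n where n: "\<And>v. (bracket E ^^ n) v = 0"
    using raising_nilpotent[OF endo_ad endo_ad rel] by auto
  have ef: "\<langle>E, \<langle>Z, v\<rangle>\<rangle> = \<langle>Z, \<langle>E, v\<rangle>\<rangle> + \<langle>H, v\<rangle>" for v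
    using bracket_bracket_right[of E Z v] EZ by simp
  interpret sl2_action scale UNIV "bracket E" "bracket H" "bracket Z" n
    by (intro sl2_action.intro endo_space_axioms sl2_action_axioms.intro)
      (rule subspace_UNIV endo_ad UNIV_I rel ef n)+
  let ?U = "\<langle>H, Z\<rangle> + 2 *s Z"
  have "\<langle>E, \<langle>H, Z\<rangle>\<rangle> = - (2 *s H)"
    using rel[of Z] EZ by (simp add: bracket_simps algebra_simps eq_neg_iff_add_eq_0)
  then have "\<langle>E, ?U\<rangle> = 0" by (simp add: bracket_simps EZ)
  then obtain W where W: "\<langle>E, W\<rangle> = 0" "?U = \<langle>H, W\<rangle> + 2 *s W"
    using kernel_h_plus_2_surj by blast
  have "\<langle>E, Z - W\<rangle> = H" using W(1) EZ by (simp add: bracket_simps)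
  moreover have "\<langle>H, Z - W\<rangle> + 2 *s (Z - W) = 0"
    using W(2) by (simp add: bracket_simps scale_right_diff_distrib algebra_simps)
  ultimately show ?thesis using that by (simp add: eq_neg_iff_add_eq_0)
qed

definition sl2_triple :: "'v \<Rightarrow> 'v \<Rightarrow> 'v \<Rightarrow> bool" where
  "sl2_triple E H F \<longleftrightarrow> \<langle>H, E\<rangle> = 2 *s E \<and> \<langle>E, F\<rangle> = H \<and> \<langle>H, F\<rangle> = - (2 *s F)"

text \<open>As \<open>A\<close> is abelian, relations that hold modulo \<open>A\<close> act exactly
  on \<open>A\<close>. The error of \<open>[H, E]\<close> is removed by changing \<open>E\<close>
  and \<open>H\<close>, that of \<open>[E, F]\<close> by changing \<open>H\<close> and
  \<open>F\<close>, and \<open>jacobson_morozov\<close> repairs the last relation. That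
  \<open>E' - E\<close> lies in \<open>A\<close> is recorded to keep \<open>E'\<close>
  nonzero.\<close>

lemma sl2_triple_lift:
  assumes A: "ideal A" "abelian A"
    and "\<langle>H, E\<rangle> - 2 *s E \<in> A" "\<langle>E, F\<rangle> - H \<in> A" "\<langle>H, F\<rangle> + 2 *s F \<in> A"
  obtains E' H' F' where "sl2_triple E' H' F'" "E' - E \<in> A"
proof -
  note I = idealD[OF A(1)]
  note abl = A(2)[unfolded abelian_def, rule_format]
  obtain P where P: "endo P" "\<And>v. P (P v) = P v" "\<And>v. P v = 0 \<longleftrightarrow> v \<in> A"
    using subspace_projection[OF I(1)] by blast
  define Q where "Q = (\<lambda>v. v - P v)"
  have Q: "endo Q" "Q v \<in> A" "v \<in> A \<Longrightarrow> Q v = v" for v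
  proof -
    show "endo Q" unfolding Q_def by (rule endo_minus[OF endo_ident P(1)])
    have "P (Q v) = 0" by (simp add: Q_def P(2) endo_simps[OF P(1)])
    then show "Q v \<in> A" by (simp add: P(3))
    show "Q v = v" if "v \<in> A" using that P(3)[of v] by (simp add: Q_def)
  qed
  have action: "\<exists>n. sl2_action scale A (bracket E) (bracket H) (bracket F) n"
    if rel: "\<langle>H, E\<rangle> - 2 *s E \<in> A" "\<langle>E, F\<rangle> - H \<in> A" for E H F
  proof -
    have he: "\<langle>H, \<langle>E, v\<rangle>\<rangle> = \<langle>E, \<langle>H, v\<rangle>\<rangle> + 2 *s \<langle>E, v\<rangle>" if "v \<in> A" for v
      using abl[OF rel(1) that] by (simp add: bracket_bracket_right[of H E v] bracket_simps)
    have ef: "\<langle>E, \<langle>F, v\<rangle>\<rangle> = \<langle>F, \<langle>E, v\<rangle>\<rangle> + \<langle>H, v\<rangle>" if "v \<in> A" for v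
      using abl[OF rel(2) that] by (simp add: bracket_bracket_right[of E F v] bracket_simps)
    \<comment> \<open>Precomposing with \<open>Q\<close> extends the action on \<open>A\<close> to
      the whole space, where \<open>raising_nilpotent\<close> applies.\<close>
    obtain n where n: "\<And>v. ((\<lambda>v. \<langle>E, Q v\<rangle>) ^^ n) v = 0"
    proof (rule raising_nilpotent)
      show "endo (\<lambda>v. \<langle>H, Q v\<rangle>)" "endo (\<lambda>v. \<langle>E, Q v\<rangle>)"
        by (intro endo_compose[OF endo_ad Q(1)])+
      show "\<langle>H, Q \<langle>E, Q v\<rangle>\<rangle> = \<langle>E, Q \<langle>H, Q v\<rangle>\<rangle> + 2 *s \<langle>E, Q v\<rangle>" for v
        using I Q he[of "Q v"] by simp
    qed auto
    have "(bracket E ^^ k) v = ((\<lambda>v. \<langle>E, Q v\<rangle>) ^^ k) v \<and> (bracket E ^^ k) v \<in> A" if "v \<in> A" for v k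
      by (induction k) (use that I Q in auto)
    then have "(bracket E ^^ n) v = 0" if "v \<in> A" for v using n that by simp
    then have "sl2_action scale A (bracket E) (bracket H) (bracket F) n"
      by (intro sl2_action.intro endo_space_axioms sl2_action_axioms.intro)
        (rule I(1) endo_ad | erule I(2) he ef | assumption)+
    then show ?thesis ..
  qed
  obtain n where n: "sl2_action scale A (bracket E) (bracket H) (bracket F) n"
    using action assms(3,4) by blast
  obtain x y where xy: "x \<in> A" "y \<in> A" "\<langle>H, E\<rangle> - 2 *s E = 2 *s y - \<langle>H, y\<rangle> + \<langle>E, x\<rangle>"
    using sl2_action.h_minus_2_e_surj[OF n assms(3)] by blast
  let ?E = "E + y" and ?H = "H + x"
  have "\<langle>E, x\<rangle> = - \<langle>x, E\<rangle>" by (rule bracket_anticommute)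
  then have HE: "\<langle>?H, ?E\<rangle> = 2 *s ?E"
    using xy(3) abl[OF xy(1,2)] by (simp add: bracket_simps algebra_simps)
  let ?l = "\<langle>?E, F\<rangle> - ?H" and ?m = "\<langle>?H, F\<rangle> + 2 *s F"
  have "?l = (\<langle>E, F\<rangle> - H) + \<langle>y, F\<rangle> - x" "?m = (\<langle>H, F\<rangle> + 2 *s F) + \<langle>x, F\<rangle>"
    by (simp_all add: bracket_simps)
  moreover have "(\<langle>E, F\<rangle> - H) + \<langle>y, F\<rangle> - x \<in> A" "(\<langle>H, F\<rangle> + 2 *s F) + \<langle>x, F\<rangle> \<in> A"
    by (intro subspace_diff[OF I(1)] subspace_add[OF I(1)] assms(4,5) I(3) xy)+
  ultimately have lm: "?l \<in> A" "?m \<in> A" by metis+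
  obtain n' where n': "sl2_action scale A (bracket ?E) (bracket ?H) (bracket F) n'"
    using action[of ?H ?E F] lm(1) HE subspace_0[OF I(1)] by auto
  \<comment> \<open>By the Jacobi identity the two remaining errors satisfy
    \<open>[?H, ?l] = [?E, ?m]\<close>, as \<open>weight_zero_decomposition\<close>
    requires.\<close>
  have "\<langle>?H, \<langle>?E, F\<rangle>\<rangle> = \<langle>2 *s ?E, F\<rangle> + \<langle>?E, \<langle>?H, F\<rangle>\<rangle>"
    unfolding bracket_bracket_right[of ?H ?E F] HE ..
  then have "\<langle>?H, ?l\<rangle> = \<langle>?E, ?m\<rangle>"
    by (simp only: bracket_right(5) bracket_self bracket_left(2)) (simp only: bracket_right(1,2) add.commute diff_zero)
  then obtain x' w where w: "x' \<in> A" "w \<in> A" "\<langle>?E, x'\<rangle> = 0" "?l = x' + \<langle>?E, w\<rangle>"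
    using sl2_action.weight_zero_decomposition[OF n' lm] by blast
  have "\<langle>x', ?E\<rangle> = 0" using w(3) bracket_anticommute[of x' ?E] by simp
  then have "\<langle>?H + x', ?E\<rangle> = 2 *s ?E" using HE by (simp only: bracket_left(1) add_0_right)
  moreover have "\<langle>?E, F - w\<rangle> = ?H + x'"
    using w(4) by (simp only: bracket_right(5)) (simp add: algebra_simps)
  ultimately obtain F' where "\<langle>?E, F'\<rangle> = ?H + x'" "\<langle>?H + x', F'\<rangle> = - (2 *s F')"
    using jacobson_morozov by blast
  then have "sl2_triple ?E (?H + x') F'"
    unfolding sl2_triple_def using \<open>\<langle>?H + x', ?E\<rangle> = 2 *s ?E\<close> by blast
  then show ?thesis using that xy(2) by simp
qed

text \<open>The product of \<open>e = ad E\<close> and \<open>z = ad Z\<close> is nilpotent, so its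
  trace vanishes. \<open>Q\<close> expands \<open>ad [E, [E, Z]] = 0\<close>; with
  \<open>e e e = 0\<close> it makes each of \<open>e e z e\<close> and \<open>e z e e\<close> twice
  the other, hence both zero.\<close>

lemma killing_square_zero:
  assumes cube: "\<And>v. \<langle>E, \<langle>E, \<langle>E, v\<rangle>\<rangle>\<rangle> = 0" and Z: "\<langle>E, \<langle>E, Z\<rangle>\<rangle> = 0"
  shows "killing E Z = 0"
proof -
  let ?e = "bracket E" and ?z = "bracket Z"
  have Q: "?e (?e (?z v)) + ?z (?e (?e v)) = 2 *s ?e (?z (?e v))" for v
  proof -
    have two: "2 *s x = x + x" for x
      by (metis one_add_one scale_left_distrib scale_one)
    have "\<langle>\<langle>E, \<langle>E, Z\<rangle>\<rangle>, v\<rangle> = 0" using Z by (simp add: bracket_simps)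
    then show ?thesis
      by (simp add: bracket_bracket_left two bracket_simps algebra_simps)
  qed
  have 1: "?e (?e (?z (?e v))) = 2 *s ?e (?z (?e (?e v)))" for v
    using Q[of "?e v"] cube[of v] by (simp add: bracket_simps)
  have 2: "?e (?z (?e (?e v))) = 2 *s ?e (?e (?z (?e v)))" for v
    using arg_cong[OF Q[of v], of ?e] cube[of "?z v"] by (simp add: bracket_simps)
  have 3: "?e (?z (?e (?e v))) = 0" for v
  proof -
    have "?e (?z (?e (?e v))) = 4 *s ?e (?z (?e (?e v)))"
      using 2[of v] 1[of v] by simp
    then have "(4 - 1) *s ?e (?z (?e (?e v))) = 0"
      by (simp only: scale_left_diff_distrib scale_one right_minus_eq)
    then show ?thesis by (simp add: scale_eq_0_iff)
  qed
  have 4: "?e (?e (?z (?e v))) = 0" for v using 1[of v] 3[of v] by simp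
  \<comment> \<open>By \<open>Q\<close> and \<open>4\<close>,
    \<open>2 e z e z e z = e e z z e z\<close>; another \<open>e z\<close> in front produces a
    leading \<open>e z e e\<close>, which is zero.\<close>
  have "2 *s ?e (?z (?e (?z (?e (?z (?e (?z v))))))) = 0" for v
  proof -
    have "2 *s ?e (?z (?e (?z (?e (?z v))))) = ?e (?e (?z (?z (?e (?z v)))))"
      using Q[of "?z (?e (?z v))"] 4[of "?z v"] by (simp add: bracket_simps)
    then show ?thesis using 3[of "?z (?z (?e (?z v)))"] by (metis bracket_right(2))
  qed
  then have "((\<lambda>v. ?e (?z v)) ^^ 4) v = 0" for v
    by (simp add: numeral_eq_Suc scale_eq_0_iff)
  then show ?thesis
    unfolding killing_def by (rule trace_nilpotent[OF independent_Basis span_Basis endo_compose[OF endo_ad endo_ad]])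
qed

text \<open>
  An eigenvector \<open>E\<close> of some \<open>ad H\<close> for an eigenvalue of maximal modulus satisfies \<open>(ad E)\<^sup>3 = 0\<close>, so it
  is Killing-orthogonal to the kernel of \<open>(ad E)\<^sup>2\<close> and therefore lies in the image of \<open>(ad E)\<^sup>2\<close>.
  This is the input that the Jacobson-Morozov argument needs.
\<close>

lemma sl2_triple_if_no_abelian_ideal:
  assumes no_ab: "\<And>A. ideal A \<Longrightarrow> abelian A \<Longrightarrow> A \<subseteq> derived_algebra \<Longrightarrow> A = {0}"
    and nontriv: "derived_algebra \<noteq> {0}"
  obtains E H F where "sl2_triple E H F" "E \<noteq> 0"
proof -
  have derived: "ideal derived_algebra" by (intro ideal_bracket_span ideal_UNIV)
  have no_nil: "J = {0}"
    if "ideal J" "J \<subseteq> derived_algebra" "\<And>x. x \<in> J \<Longrightarrow> \<exists>k. \<forall>v. (bracket x ^^ k) v = 0" for J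
    using nil_ideal_contains_abelian_ideal[OF that(1) _ that(3)] no_ab that(2) by (metis subset_trans)
  \<comment> \<open>For the intersection \<open>J\<close>, the ideal \<open>[J, J]\<close> consists
    of ad-nilpotent elements and hence vanishes; so \<open>J\<close> is abelian and vanishes
    too.\<close>
  have rad: "killing_radical \<inter> derived_algebra = {0}" (is "?J = _")
  proof -
    have J: "ideal ?J" by (intro ideal_Int ideal_killing_radical derived)
    have "bracket_span ?J ?J \<subseteq> ?J"
      using idealD[OF J] by (intro bracket_span_subset) auto
    moreover have "bracket_span ?J ?J \<subseteq> bracket_span killing_radical killing_radical"
      unfolding bracket_span_def by (intro span_mono) auto
    ultimately have "bracket_span ?J ?J = {0}"
      using nilpotent_if_in_radical_bracket by (intro no_nil ideal_bracket_span J) (blast, metis subsetD)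
    then have "abelian ?J"
      unfolding abelian_def using bracket_in_bracket_span[of _ ?J _ ?J] by blast
    with J show ?thesis by (intro no_ab) auto
  qed
  obtain H0 where H0: "\<not> (\<exists>k. \<forall>v. (bracket H0 ^^ k) v = 0)"
    using no_nil[OF derived order_refl] nontriv by blast
  obtain B ev where B: "independent B" "span B = UNIV" "\<And>b. b \<in> B \<Longrightarrow> b \<in> gen_eigenspace (bracket H0) (ev b)"
    using gen_eigenbasis_exists[OF endo_ad] by blast
  have "\<exists>b\<in>B. ev b \<noteq> 0"
  proof (rule ccontr)
    assume "\<not> (\<exists>b\<in>B. ev b \<noteq> 0)"
    then have "\<exists>k. (bracket H0 ^^ k) b = 0" if "b \<in> B" for b
      using B(3)[OF that] that by (auto simp: gen_eigenspace_def)
    then show False using nilpotent_if_locally_nilpotent[OF endo_ad B(2)] H0 by metis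
  qed
  then obtain b0 where b0: "b0 \<in> B" "ev b0 \<noteq> 0" by blast
  let ?N = "(\<lambda>b. norm (ev b)) ` B"
  have fin: "finite ?N" using B(1) finiteI_independent by blast
  then have "Max ?N \<in> ?N" using b0 by (intro Max_in) auto
  then obtain b where b: "b \<in> B" "Max ?N = norm (ev b)" by blast
  then have max: "norm (ev b') \<le> norm (ev b)" if "b' \<in> B" for b'
    using fin that by (metis Max_ge imageI)
  let ?a = "ev b"
  have a: "norm ?a > 0" using max[OF b0(1)] b0(2) by (metis norm_le_zero_iff not_le order_trans)
  have "b \<noteq> 0" using B(1) b(1) dependent_zero by blast
  then obtain E where E: "E \<noteq> 0" "\<langle>H0, E\<rangle> = ?a *s E"
    using gen_eigenspace_eigenvector[OF endo_ad B(3)[OF b(1)]] by blast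
  have "E = (1 / ?a) *s \<langle>H0, E\<rangle>" using E(2) a by auto
  then have Ed: "E \<in> derived_algebra"
    using bracket_in_bracket_span[of H0 UNIV E UNIV] subspace_scale[OF idealD(1)[OF derived]]
    by (metis UNIV_I)
  have cube: "\<langle>E, \<langle>E, \<langle>E, v\<rangle>\<rangle>\<rangle> = 0" for v
  proof -
    \<comment> \<open>Three applications of \<open>ad E\<close> shift the eigenvalue by
      \<open>3 a\<close>, to modulus at least \<open>3 |a| - |a|\<close>, beyond the maximum
      \<open>|a|\<close>.\<close>
    have "(bracket E ^^ 3) b' = (0 *s b')" if b': "b' \<in> B" for b'
    proof -
      have "(bracket E ^^ 3) b' \<in> gen_eigenspace (bracket H0) (ev b' + of_nat 3 * ?a)"
        by (rule gen_eigenspace_raise_power[OF endo_ad endo_ad _ B(3)[OF b']])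
           (simp add: bracket_bracket_right[of H0 E] E(2) bracket_simps add.commute)
      moreover have "ev b' + of_nat 3 * ?a \<notin> ev ` B"
      proof
        assume "ev b' + of_nat 3 * ?a \<in> ev ` B"
        then have "norm (ev b' + of_nat 3 * ?a) \<le> norm ?a" using max by auto
        moreover have "norm (of_nat 3 * ?a) \<le> norm (ev b' + of_nat 3 * ?a) + norm (ev b')"
          using norm_triangle_ineq4[of "ev b' + of_nat 3 * ?a" "ev b'"] by simp
        ultimately show False using max[OF b'] a by (simp add: norm_mult)
      qed
      ultimately show ?thesis using gen_eigenspace_trivial[OF endo_ad B] by simp
    qed
    then have "(bracket E ^^ 3) v = 0 *s v"
      by (rule endo_eq_on_span[OF endo_power[OF endo_ad] endo_scaled[OF endo_ident]]) (auto simp: B(2))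
    then show ?thesis by (simp add: numeral_eq_Suc)
  qed
  have double: "endo (\<lambda>v. \<langle>E, \<langle>E, v\<rangle>\<rangle>)" by (rule endo_compose[OF endo_ad endo_ad])
  \<comment> \<open>\<open>K\<close> may be degenerate, so its radical is added to the image; the
    component \<open>r\<close> is removed afterwards because the radical meets the derived algebra
    trivially.\<close>
  let ?S = "{x + y | x y. x \<in> range (\<lambda>v. \<langle>E, \<langle>E, v\<rangle>\<rangle>) \<and> y \<in> killing_radical}"
  have S: "subspace ?S"
    by (intro subspace_sums subspace_image_endo[OF double] subspace_UNIV idealD(1)[OF ideal_killing_radical])
  have "E \<in> ?S"
  proof (rule ccontr)
    assume "E \<notin> ?S"
    then obtain f where f: "Vector_Spaces.linear scale (*) f" "\<And>X. X \<in> ?S \<Longrightarrow> f X = 0" "f E = 1"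
      using separating_functional[OF S] by blast
    have f0: "f \<langle>E, \<langle>E, X\<rangle>\<rangle> = 0" for X
      using f(2)[of "\<langle>E, \<langle>E, X\<rangle>\<rangle>"] subspace_0[OF idealD(1)[OF ideal_killing_radical]] by force
    have "f X = 0" if "X \<in> killing_radical" for X
      using f(2)[of X] subspace_0[OF subspace_image_endo[OF double subspace_UNIV]] that by force
    then obtain W where W: "\<And>X. f X = killing W X"
      using killing_represents[OF f(1)] by blast
    have inv: "killing \<langle>E, Y\<rangle> X = - killing Y \<langle>E, X\<rangle>" for X Y
      using killing_invariant[of Y E X] by (simp add: bracket_anticommute[of E Y] killing_minus)
    have "killing \<langle>E, \<langle>E, W\<rangle>\<rangle> X = 0" for X
      using f0[of X] by (simp add: inv W)
    then have "\<langle>E, \<langle>E, W\<rangle>\<rangle> \<in> killing_radical \<inter> derived_algebra"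
      by (auto simp: killing_radical_def bracket_in_bracket_span)
    then have "killing E W = 0"
      using killing_square_zero[OF cube, of W] rad by simp
    with W[of E] f(3) show False by (simp add: killing_commute)
  qed
  then obtain x r where x: "E = x + r" "x \<in> range (\<lambda>v. \<langle>E, \<langle>E, v\<rangle>\<rangle>)" and r: "r \<in> killing_radical" by blast
  from x(2) obtain W where x': "x = \<langle>E, \<langle>E, W\<rangle>\<rangle>" by (rule rangeE)
  have W: "E = \<langle>E, \<langle>E, W\<rangle>\<rangle> + r" using x(1) unfolding x'[symmetric] .
  have "r = E - \<langle>E, \<langle>E, W\<rangle>\<rangle>" using W by (simp add: algebra_simps)
  then have "r \<in> derived_algebra"
    using Ed by (simp add: subspace_diff[OF idealD(1)[OF derived]] bracket_in_bracket_span)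
  with r rad have "r = 0" by blast
  then have EW: "\<langle>E, \<langle>E, W\<rangle>\<rangle> = E" using W by simp
  \<comment> \<open>\<open>[[E, W], E] = - E\<close>, so the factor \<open>- 2\<close> normalizes
    the eigenvalue to \<open>2\<close>.\<close>
  let ?H = "- (2 *s \<langle>E, W\<rangle>)"
  have "\<langle>?H, E\<rangle> = 2 *s E"
    using EW bracket_anticommute[of "\<langle>E, W\<rangle>" E] by (simp add: bracket_simps)
  moreover have "\<langle>E, - (2 *s W)\<rangle> = ?H" by (simp add: bracket_simps)
  ultimately obtain F where "sl2_triple E ?H F"
    using jacobson_morozov unfolding sl2_triple_def by metis
  with E(1) show ?thesis using that by blast
qed

section \<open>Incompatibility of a triple with the derivation\<close>

lemma dual_derivation_killing_imp_no_sl2_triple: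
  assumes D: "dual_derivation D" "\<And>X Y. killing X Y = D X Y + D Y X"
    and "sl2_triple E H F"
  shows "E = 0"
proof (rule ccontr)
  assume "E \<noteq> 0"
  have HE: "\<langle>H, E\<rangle> = 2 *s E" and EF: "\<langle>E, F\<rangle> = H" and HF: "\<langle>H, F\<rangle> = - (2 *s F)"
    using assms(3) by (auto simp: sl2_triple_def)
  have EH: "\<langle>E, H\<rangle> = - (2 *s E)" and FH: "\<langle>F, H\<rangle> = 2 *s F"
    using HE HF bracket_anticommute[of E H] bracket_anticommute[of F H] by auto
  have D_scale: "D X (c *s Y) = c * D X Y" "D X (- Y) = - D X Y" for X Y c
  proof -
    have lin: "\<And>c Y. D X (c *s Y) = c * D X Y"
      using D(1) by (simp add: dual_derivation_def linear_to_dual_def Vector_Spaces.linear_iff)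
    then show "D X (c *s Y) = c * D X Y" .
    show "D X (- Y) = - D X Y" using lin[of "- 1" Y] by simp
  qed
  have "D \<langle>E, F\<rangle> H = D E \<langle>F, H\<rangle> - D F \<langle>E, H\<rangle>"
    using D(1) by (simp add: dual_derivation_def)
  then have "D H H = 2 * killing E F"
    by (simp add: EF FH EH D_scale D(2))
  moreover have "killing H H = 2 * killing E F"
    using killing_invariant[of E F H] by (simp add: EF FH killing_lin)
  ultimately have "killing H H = 0" using D(2)[of H H] by simp
  obtain B ev where B: "independent B" "span B = UNIV" "\<And>b. b \<in> B \<Longrightarrow> b \<in> gen_eigenspace (bracket H) (ev b)"
    using gen_eigenbasis_exists[OF endo_ad] by blast
  have HH: "endo (\<lambda>v. \<langle>H, \<langle>H, v\<rangle>\<rangle>)" by (rule endo_compose[OF endo_ad endo_ad])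
  have "killing H H = (\<Sum>b\<in>B. (ev b)\<^sup>2)"
    unfolding killing_def
  proof (rule trace_eq_sum_eigenvalues[OF endo_ad B independent_Basis span_Basis HH])
    fix a v assume v: "v \<in> gen_eigenspace (bracket H) a"
    then show "\<langle>H, \<langle>H, v\<rangle>\<rangle> \<in> gen_eigenspace (bracket H) a"
      using gen_eigenspace_commute[OF endo_ad endo_ad] by blast
    note sub = subspace_gen_eigenspace[OF HH, of "a\<^sup>2"]
    from endo_ad v show "v \<in> gen_eigenspace (\<lambda>v. \<langle>H, \<langle>H, v\<rangle>\<rangle>) (a\<^sup>2)"
    proof (induction rule: gen_eigenspace_induct)
      case zero
      then show ?case by (rule subspace_0[OF sub])
    next
      case (step v)
      let ?w = "\<langle>H, v\<rangle> - a *s v"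
      have "\<langle>H, ?w\<rangle> \<in> gen_eigenspace (\<lambda>v. \<langle>H, \<langle>H, v\<rangle>\<rangle>) (a\<^sup>2)"
        by (rule gen_eigenspace_commute[OF HH endo_ad _ step.IH]) simp
      then have "\<langle>H, ?w\<rangle> + a *s ?w \<in> gen_eigenspace (\<lambda>v. \<langle>H, \<langle>H, v\<rangle>\<rangle>) (a\<^sup>2)"
        using step.IH by (intro subspace_add[OF sub] subspace_scale[OF sub])
      also have "\<langle>H, ?w\<rangle> + a *s ?w = \<langle>H, \<langle>H, v\<rangle>\<rangle> - a\<^sup>2 *s v"
        by (simp add: bracket_simps scale_right_diff_distrib power2_eq_square)
      finally show ?case by (rule gen_eigenspace_stepD)
    qed
  qed
  have rel: "\<langle>H, \<langle>E, v\<rangle>\<rangle> = \<langle>E, \<langle>H, v\<rangle>\<rangle> + 2 *s \<langle>E, v\<rangle>" for v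
    by (simp add: bracket_bracket_right[of H E v] HE bracket_simps)
  obtain n where n: "\<And>v. (bracket E ^^ n) v = 0"
    using raising_nilpotent[OF endo_ad endo_ad rel] by auto
  have ef: "\<langle>E, \<langle>F, v\<rangle>\<rangle> = \<langle>F, \<langle>E, v\<rangle>\<rangle> + \<langle>H, v\<rangle>" for v
    using bracket_bracket_right[of E F v] EF by simp
  interpret sl2_action scale UNIV "bracket E" "bracket H" "bracket F" n
    by (intro sl2_action.intro endo_space_axioms sl2_action_axioms.intro)
      (rule subspace_UNIV endo_ad UNIV_I rel ef n)+
  \<comment> \<open>Powers of \<open>ad E\<close> raise an eigenvector of \<open>ad H\<close> in
    steps of \<open>2\<close> to a nonzero vector killed by \<open>ad E\<close>, whose eigenvalue is
    a natural number \<open>m\<close>; hence \<open>ev b = m - 2 j\<close>.\<close>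
  have real: "\<exists>r::real. ev b = of_real r" if b: "b \<in> B" for b
  proof -
    have "b \<noteq> 0" using B(1) b dependent_zero by blast
    then obtain u where u: "u \<noteq> 0" "\<langle>H, u\<rangle> = ev b *s u"
      using gen_eigenspace_eigenvector[OF endo_ad B(3)[OF b]] by blast
    define k where "k = (LEAST k. (bracket E ^^ k) u = 0)"
    have k: "(bracket E ^^ k) u = 0" unfolding k_def using n by (rule LeastI)
    then obtain j where j: "k = Suc j" using u(1) by (cases k) auto
    let ?w = "(bracket E ^^ j) u"
    have "?w \<noteq> 0" using not_less_Least[of j "\<lambda>k. (bracket E ^^ k) u = 0"] j k_def by simp
    moreover have "\<langle>E, ?w\<rangle> = 0" using k j by simp
    moreover have "\<langle>H, ?w\<rangle> = (ev b + of_nat (2 * j)) *s ?w"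
      using power_h[of u j] u(2) by (simp add: scale_left_distrib[symmetric] endo_scale[OF endo_power[OF endo_ad]])
    ultimately obtain m where "ev b + of_nat (2 * j) = of_nat m"
      using primitive_eigenvalue[of ?w] by auto
    then have "ev b = of_real (real m - real (2 * j))" by (simp add: algebra_simps)
    then show ?thesis ..
  qed
  have sq: "(ev b)\<^sup>2 = of_real ((Re (ev b))\<^sup>2)" if "b \<in> B" for b
    using real[OF that] by auto
  have "(\<Sum>b\<in>B. (ev b)\<^sup>2) = of_real (\<Sum>b\<in>B. (Re (ev b))\<^sup>2)"
    using sq by simp
  then have "(\<Sum>b\<in>B. (Re (ev b))\<^sup>2) = 0"
    using \<open>killing H H = 0\<close> \<open>killing H H = (\<Sum>b\<in>B. (ev b)\<^sup>2)\<close> by (simp only: of_real_eq_0_iff)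
  then have zero: "(ev b)\<^sup>2 = 0" if "b \<in> B" for b
    using sq that B(1) finiteI_independent by (subst (asm) sum_nonneg_eq_0_iff) auto
  have "E \<in> gen_eigenspace (bracket H) 2"
    by (rule gen_eigenspaceI[where k = 1]) (simp add: HE)
  then have "2 \<in> ev ` B"
    using gen_eigenspace_trivial[OF endo_ad B] \<open>E \<noteq> 0\<close> by blast
  with zero show False by auto
qed

text \<open>
  The quotient by an abelian ideal \<open>A\<close> is modelled on the same vector space: composing the bracket with
  a projection along \<open>A\<close> gives the direct sum of the quotient and the trivial algebra \<open>A\<close>.
\<close>

lemma sl2_triple_if_not_solvable_step:
  assumes IH: "\<And>br. complex_lie_algebra scale br Basis \<Longrightarrow> \<not> lie_algebra.solvable scale br \<Longrightarrow>
      dim (fd_lie_algebra.bracket_span scale br UNIV UNIV) < dim derived_algebra \<Longrightarrow>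
      \<exists>E H F. complex_lie_algebra.sl2_triple scale br E H F \<and> E \<noteq> 0"
    and nonsolv: "\<not> solvable"
  shows "\<exists>E H F. sl2_triple E H F \<and> E \<noteq> 0"
  proof (cases "\<exists>A. ideal A \<and> abelian A \<and> A \<subseteq> derived_algebra \<and> A \<noteq> {0}")
    case False
    have "derived_algebra \<noteq> {0}"
    proof
      assume "derived_algebra = {0}"
      then have "derived_series 1 = {0}" by (simp only: One_nat_def derived_series_Suc derived_series.simps(1))
      then show False using nonsolv unfolding solvable_def by blast
    qed
    then show ?thesis using False sl2_triple_if_no_abelian_ideal by metis
  next
    case True
    then obtain A where A: "ideal A" "abelian A" "A \<subseteq> derived_algebra" "A \<noteq> {0}" by blast
    note I = idealD[OF A(1)]
    obtain P where P: "endo P" "\<And>v. P (P v) = P v" "\<And>v. P v = 0 \<longleftrightarrow> v \<in> A"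
      using subspace_projection[OF I(1)] by blast
    note P_lin = endo_simps[OF P(1)]
    have PA: "P u = P v" if "u - v \<in> A" for u v using that P(3)[of "u - v"] by (simp add: P_lin)
    have diff: "v - P v \<in> A" for v using P(2,3) by (simp add: P(3)[symmetric] P_lin)
    have P_right: "P \<langle>X, P Y\<rangle> = P \<langle>X, Y\<rangle>" for X Y
      using PA[of "\<langle>X, Y\<rangle>" "\<langle>X, P Y\<rangle>"] I(2)[OF diff, of X Y] by (simp add: bracket_right)
    have P_left: "P \<langle>P X, Y\<rangle> = P \<langle>X, Y\<rangle>" for X Y
      using PA[of "\<langle>X, Y\<rangle>" "\<langle>P X, Y\<rangle>"] I(3)[OF diff, of X Y] by (simp add: bracket_left)
    define br where "br = (\<lambda>X Y. P \<langle>X, Y\<rangle>)"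
    have br: "complex_lie_algebra scale br Basis"
    proof (intro complex_lie_algebra.intro fd_lie_algebra.intro lie_algebra.intro lie_algebra_axioms.intro
        vector_space_axioms fd_endo_space_axioms complex_endo_space_axioms)
      show "endo (br X)" for X unfolding br_def by (rule endo_compose[OF P(1) endo_ad])
      show "endo (\<lambda>X. br X Y)" for Y unfolding br_def by (rule endo_compose[OF P(1) endo_bracket_left])
      show "br X X = 0" for X by (simp add: br_def bracket_self P_lin)
      show "br X (br Y Z) + br Y (br Z X) + br Z (br X Y) = 0" for X Y Z
        by (simp add: br_def P_right P_lin(1)[symmetric] jacobi P_lin(3))
    qed
    interpret Q: complex_lie_algebra scale br Basis by (rule br)
    have der: "Q.derived_algebra \<subseteq> P ` derived_algebra"
      using bracket_in_bracket_span[of _ UNIV _ UNIV] subspace_image_endo[OF P(1)] ideal_bracket_span[OF ideal_UNIV ideal_UNIV]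
      by (intro Q.bracket_span_subset) (auto simp: br_def ideal_def)
    have "P v \<in> derived_algebra" if "v \<in> derived_algebra" for v
    proof -
      have "v - P v \<in> derived_algebra" using diff A(3) by blast
      from subspace_diff[OF idealD(1)[OF ideal_bracket_span[OF ideal_UNIV ideal_UNIV]] that this]
      show ?thesis by simp
    qed
    with der have sub: "Q.derived_algebra \<subseteq> derived_algebra" by blast
    obtain x where x: "x \<in> A" "x \<noteq> 0" using A(4) subspace_0[OF I(1)] by auto
    \<comment> \<open>The derived algebra of the quotient lies in the image of \<open>P\<close>,
      which meets \<open>A\<close> only in \<open>0\<close>; \<open>x\<close> thus witnesses a
      strict drop of the dimension.\<close>
    have "x \<notin> Q.derived_algebra"
      using der x P(2,3) by (metis imageE subsetD)
    then have "dim Q.derived_algebra < dim derived_algebra"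
      using sub x A(3) idealD(1)[OF ideal_bracket_span[OF ideal_UNIV ideal_UNIV]]
        Q.idealD(1)[OF Q.ideal_bracket_span[OF Q.ideal_UNIV Q.ideal_UNIV]]
      by (intro dim_psubset) (auto simp: span_eq_iff[THEN iffD2])
    moreover have "\<not> Q.solvable"
    proof
      assume "Q.solvable"
      then obtain n where n: "Q.derived_series n = {0}" by (auto simp: Q.solvable_def)
      have sub: "subspace (Q.derived_series k)" for k
        by (cases k) (simp_all add: Q.derived_series_Suc Q.bracket_span_def del: Q.derived_series.simps(2))
      have "derived_series k \<subseteq> {X. P X \<in> Q.derived_series k}" for k
      proof (induction k)
        case (Suc k)
        have "derived_series (Suc k) \<subseteq> {X. P X \<in> Q.derived_series (Suc k)}"
          unfolding derived_series_Suc
        proof (rule bracket_span_subset)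
          fix X Y assume "X \<in> derived_series k" "Y \<in> derived_series k"
          then have "br (P X) (P Y) \<in> Q.derived_series (Suc k)"
            unfolding Q.derived_series_Suc using Suc by (intro Q.bracket_in_bracket_span) auto
          then show "\<langle>X, Y\<rangle> \<in> {X. P X \<in> Q.derived_series (Suc k)}"
            by (simp add: br_def P_left P_right del: Q.derived_series.simps)
        next
          show "subspace {X. P X \<in> Q.derived_series (Suc k)}"
            using sub[of "Suc k"] by (simp add: subspace_def P_lin del: Q.derived_series.simps)
        qed
        then show ?case .
      qed simp
      then have "derived_series n \<subseteq> A" using n P(3) by blast
      then have "derived_series (Suc n) \<subseteq> {0}"
        unfolding derived_series_Suc using A(2)
        by (intro bracket_span_subset) (auto simp: abelian_def)
      moreover have "0 \<in> derived_series (Suc n)" by (simp add: span_zero)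
      ultimately have "derived_series (Suc n) = {0}" by blast
      then show False using nonsolv unfolding solvable_def by blast
    qed
    ultimately obtain E H F where t: "Q.sl2_triple E H F" "E \<noteq> 0"
      using IH[OF br] by blast
    then have tr: "P \<langle>H, E\<rangle> = 2 *s E" "P \<langle>E, F\<rangle> = H" "P \<langle>H, F\<rangle> = - (2 *s F)"
      using t(1)[unfolded Q.sl2_triple_def] by (simp_all add: br_def)
    \<comment> \<open>The triple consists of multiples of values of \<open>P\<close>, on which
      \<open>P\<close> is the identity; this rules out \<open>E\<close> in \<open>A\<close>.\<close>
    have P_fix: "P E = E" "P H = H" "P F = F"
      using P(2)[of "\<langle>H, E\<rangle>"] P(2)[of "\<langle>E, F\<rangle>"] P(2)[of "\<langle>H, F\<rangle>"] unfolding tr by (simp_all add: P_lin)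
    then have "E \<notin> A" using P(3) t(2) by metis
    have "\<langle>H, E\<rangle> - 2 *s E \<in> A" "\<langle>E, F\<rangle> - H \<in> A" "\<langle>H, F\<rangle> + 2 *s F \<in> A"
      by (simp_all add: P(3)[symmetric] P_lin tr P_fix)
    then obtain E' H' F' where t': "sl2_triple E' H' F'" "E' - E \<in> A"
      using sl2_triple_lift[OF A(1,2)] by blast
    with \<open>E \<notin> A\<close> have "E' \<noteq> 0" using subspace_neg[OF I(1), of "- E"] by auto
    with t'(1) show ?thesis by blast
  qed

end

text \<open>The induction takes place outside the locale because the bracket changes at each step,
  while \<open>scale\<close> and \<open>Basis\<close> stay fixed.\<close>

lemma sl2_triple_if_not_solvable:
  assumes "complex_lie_algebra scale bracket Basis" "\<not> lie_algebra.solvable scale bracket"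
  shows "\<exists>E H F. complex_lie_algebra.sl2_triple scale bracket E H F \<and> E \<noteq> 0"
  using assms
proof (induction "vector_space.dim scale (fd_lie_algebra.bracket_span scale bracket UNIV UNIV)"
    arbitrary: bracket rule: less_induct)
  case less
  interpret complex_lie_algebra scale bracket Basis by (rule less.prems(1))
  show ?case by (rule sl2_triple_if_not_solvable_step[OF less.hyps less.prems(2)])
qed

text \<open>Stated for one derivation instead of \<open>Tstar_solitary\<close>, so that it also
  applies to a complexified real algebra.\<close>

lemma (in complex_lie_algebra) solvable_if_killing_eq_derivation:
  assumes "dual_derivation D" "\<And>X Y. killing X Y = D X Y + D Y X"
  shows solvable
  using assms dual_derivation_killing_imp_no_sl2_triple
    sl2_triple_if_not_solvable[OF complex_lie_algebra_axioms] by blast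

section \<open>Complexification\<close>

locale real_fd_lie_algebra = fd_lie_algebra scale bracket Basis
  for scale :: "real \<Rightarrow> 'v::ab_group_add \<Rightarrow> 'v" (infixr "*s" 75)
    and bracket :: "'v \<Rightarrow> 'v \<Rightarrow> 'v" ("\<langle>_, _\<rangle>")
    and Basis
begin

text \<open>A pair \<open>(x, y)\<close> stands for \<open>x + i y\<close>; \<open>cbracket\<close>
  and \<open>cform\<close> are the complex bilinear extensions of the bracket and of a real bilinear
  form.\<close>

definition cscale :: "complex \<Rightarrow> 'v \<times> 'v \<Rightarrow> 'v \<times> 'v" where
  "cscale c X = (Re c *s fst X - Im c *s snd X, Re c *s snd X + Im c *s fst X)"

definition cbracket :: "'v \<times> 'v \<Rightarrow> 'v \<times> 'v \<Rightarrow> 'v \<times> 'v" where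
  "cbracket X Y = (\<langle>fst X, fst Y\<rangle> - \<langle>snd X, snd Y\<rangle>, \<langle>fst X, snd Y\<rangle> + \<langle>snd X, fst Y\<rangle>)"

definition cBasis :: "('v \<times> 'v) set" where
  "cBasis = (\<lambda>b. (b, 0)) ` Basis"

definition cform :: "('v \<Rightarrow> 'v \<Rightarrow> real) \<Rightarrow> 'v \<times> 'v \<Rightarrow> 'v \<times> 'v \<Rightarrow> complex" where
  "cform D X Y = Complex (D (fst X) (fst Y) - D (snd X) (snd Y)) (D (fst X) (snd Y) + D (snd X) (fst Y))"

lemma vector_space_cscale: "vector_space cscale"
  by unfold_locales (simp_all add: cscale_def prod_eq_iff algebra_simps)

lemma sum_cscale_basis:
  "(\<Sum>b\<in>cBasis. cscale (c b) b) = (\<Sum>b\<in>Basis. Re (c (b, 0)) *s b, \<Sum>b\<in>Basis. Im (c (b, 0)) *s b)"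
proof -
  have "(\<Sum>b\<in>cBasis. cscale (c b) b) = (\<Sum>b\<in>Basis. cscale (c (b, 0)) (b, 0))"
    unfolding cBasis_def by (subst sum.reindex) (auto simp: inj_on_def)
  then show ?thesis by (simp add: cscale_def prod_eq_iff fst_sum snd_sum)
qed

lemma sum_cscale_representation:
  "(\<Sum>b\<in>cBasis. cscale (Complex (representation Basis (fst X) (fst b)) (representation Basis (snd X) (fst b))) b) = X"
  by (simp add: sum_cscale_basis representation_sum_basis[OF independent_Basis span_Basis])

lemma fd_endo_space_cscale: "fd_endo_space cscale cBasis"
proof -
  interpret C: vector_space cscale by (rule vector_space_cscale)
  have "c b = 0" if sum0: "(\<Sum>b\<in>cBasis. cscale (c b) b) = 0" and b: "b \<in> cBasis" for c b
  proof -
    obtain b' where b': "b = (b', 0)" "b' \<in> Basis" using b by (auto simp: cBasis_def)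
    have "(\<Sum>b\<in>Basis. Re (c (b, 0)) *s b) = 0" "(\<Sum>b\<in>Basis. Im (c (b, 0)) *s b) = 0"
      using sum0 by (simp_all add: sum_cscale_basis prod_eq_iff)
    then have "Re (c (b', 0)) = 0" "Im (c (b', 0)) = 0"
      using independentD[OF independent_Basis finite_Basis order_refl _ b'(2), of "\<lambda>b. Re (c (b, 0))"]
        independentD[OF independent_Basis finite_Basis order_refl _ b'(2), of "\<lambda>b. Im (c (b, 0))"] by simp_all
    then show ?thesis by (simp add: b' complex_eq_iff)
  qed
  then have "C.independent cBasis"
    by (intro C.independent_if_scalars_zero) (auto simp: cBasis_def finite_Basis)
  moreover have "X \<in> C.span cBasis" for X
    by (subst sum_cscale_representation[symmetric]) (intro C.span_sum C.span_scale C.span_base)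
  ultimately show ?thesis
    by unfold_locales (auto simp: cBasis_def finite_Basis)
qed

sublocale C: complex_lie_algebra cscale cbracket cBasis
proof -
  interpret C: fd_endo_space cscale cBasis by (rule fd_endo_space_cscale)
  have jac: "\<langle>X, \<langle>Y, Z\<rangle>\<rangle> = - \<langle>Y, \<langle>Z, X\<rangle>\<rangle> - \<langle>Z, \<langle>X, Y\<rangle>\<rangle>" for X Y Z
    using jacobi[of X Y Z] by (simp add: algebra_simps eq_neg_iff_add_eq_0)
  show "complex_lie_algebra cscale cbracket cBasis"
  proof (intro complex_lie_algebra.intro fd_lie_algebra.intro lie_algebra.intro lie_algebra_axioms.intro
      vector_space_cscale fd_endo_space_cscale complex_endo_space.intro)
    show "Vector_Spaces.linear cscale cscale (cbracket X)" for X
      by (rule C.endoI) (simp_all add: cbracket_def cscale_def prod_eq_iff bracket_simps algebra_simps)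
    show "Vector_Spaces.linear cscale cscale (\<lambda>X. cbracket X Y)" for Y
      by (rule C.endoI) (simp_all add: cbracket_def cscale_def prod_eq_iff bracket_simps algebra_simps)
    show "cbracket X X = 0" for X
      using bracket_anticommute[of "fst X" "snd X"]
      by (simp add: cbracket_def bracket_self prod_eq_iff)
    show "cbracket X (cbracket Y Z) + cbracket Y (cbracket Z X) + cbracket Z (cbracket X Y) = 0" for X Y Z
      using jac[of "fst X" "fst Y" "fst Z"] jac[of "fst X" "snd Y" "snd Z"] jac[of "snd X" "fst Y" "snd Z"]
        jac[of "snd X" "snd Y" "fst Z"] jac[of "snd X" "snd Y" "snd Z"] jac[of "snd X" "fst Y" "fst Z"]
        jac[of "fst X" "snd Y" "fst Z"] jac[of "fst X" "fst Y" "snd Z"]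
      by (simp add: cbracket_def prod_eq_iff bracket_simps)
  qed
qed

lemma representation_cBasis:
  assumes "b \<in> Basis"
  shows "C.representation cBasis X (b, 0) = Complex (representation Basis (fst X) b) (representation Basis (snd X) b)"
  using assms C.representation_Basis_eqI[OF sum_cscale_representation[symmetric], of "(b, 0)" X]
  by (simp add: cBasis_def)

text \<open>A real basis is also a complex basis of the complexification, so the two traces can be
  compared entry by entry.\<close>

lemma killing_complexification: "C.killing = cform killing"
proof (intro ext)
  fix X Y
  have "C.killing X Y = (\<Sum>b\<in>Basis. C.representation cBasis (cbracket X (cbracket Y (b, 0))) (b, 0))"
    unfolding C.killing_def C.trace_def
    by (rule sum.reindex_cong[of "\<lambda>b. (b, 0)"]) (auto simp: cBasis_def inj_on_def)
  also have "\<dots> = cform killing X Y"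
    by (simp add: representation_cBasis cbracket_def complex_eq_iff cform_def killing_def trace_def
        bracket_simps representation_lin[OF independent_Basis span_Basis] sum.distrib sum_subtractf)
  finally show "C.killing X Y = cform killing X Y" .
qed

lemma dual_derivation_complexification:
  assumes "dual_derivation D"
  shows "C.dual_derivation (cform D)"
proof -
  have lin: "D X (Y + Z) = D X Y + D X Z" "D X (a *s Y) = a * D X Y"
    "D (X + Y) Z = D X Z + D Y Z" "D (a *s X) Z = a * D X Z" for X Y Z a
    using assms by (simp_all add: dual_derivation_def linear_to_dual_def Vector_Spaces.linear_iff)
  have "D X (- Y) = - D X Y" "D (- X) Y = - D X Y" for X Y
    using lin(2)[of X "- 1" Y] lin(4)[of "- 1" X Y] by simp_all
  then have diff: "D X (Y - Z) = D X Y - D X Z" "D (X - Y) Z = D X Z - D Y Z" for X Y Z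
    using lin(1)[of X Y "- Z"] lin(3)[of X "- Y" Z] by simp_all
  have der: "D \<langle>X, Y\<rangle> Z = D X \<langle>Y, Z\<rangle> - D Y \<langle>X, Z\<rangle>" for X Y Z
    using assms by (simp add: dual_derivation_def)
  have "vector_space ((*) :: complex \<Rightarrow> _)"
    by unfold_locales (simp_all add: algebra_simps)
  then show ?thesis
    unfolding C.dual_derivation_def C.linear_to_dual_def Vector_Spaces.linear_iff
    by (auto simp: vector_space_cscale complex_eq_iff cform_def cscale_def cbracket_def lin diff der algebra_simps)
qed

text \<open>With this inclusion solvability descends from the complexification to the real
  algebra.\<close>

lemma derived_series_complexification: "X \<in> derived_series n \<Longrightarrow> (X, 0) \<in> C.derived_series n"
proof (induction n arbitrary: X)
  case (Suc n)
  have "bracket_span (derived_series n) (derived_series n) \<subseteq> {X. (X, 0) \<in> C.derived_series (Suc n)}"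
  proof (rule bracket_span_subset)
    fix X Y assume "X \<in> derived_series n" "Y \<in> derived_series n"
    then have "cbracket (X, 0) (Y, 0) \<in> C.derived_series (Suc n)"
      unfolding C.derived_series_Suc by (intro C.bracket_in_bracket_span Suc.IH)
    then show "\<langle>X, Y\<rangle> \<in> {X. (X, 0) \<in> C.derived_series (Suc n)}"
      by (simp add: cbracket_def bracket_simps del: C.derived_series.simps)
  next
    have sub: "C.subspace (C.derived_series (Suc n))" by simp
    show "subspace {X. (X, 0) \<in> C.derived_series (Suc n)}"
    proof (rule subspaceI; unfold mem_Collect_eq)
      show "(0, 0) \<in> C.derived_series (Suc n)"
        using C.subspace_0[OF sub] by (simp only: zero_prod_def)
      show "(X + Y, 0) \<in> C.derived_series (Suc n)"
        if "(X, 0) \<in> C.derived_series (Suc n)" "(Y, 0) \<in> C.derived_series (Suc n)" for X Y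
        using C.subspace_add[OF sub that] by simp
      show "(c *s X, 0) \<in> C.derived_series (Suc n)"
        if "(X, 0) \<in> C.derived_series (Suc n)" for c X
        using C.subspace_scale[OF sub that, of "of_real c"] by (simp add: cscale_def)
    qed
  qed
  then show ?case using Suc.prems unfolding derived_series_Suc by blast
qed simp

lemma solvable_if_Tstar_solitary:
  assumes Tstar_solitary
  shows solvable
proof -
  obtain D where D: "dual_derivation D" "\<And>X Y. killing X Y = D X Y + D Y X"
    using Tstar_solitary_killing[OF assms] by blast
  have "C.killing X Y = cform D X Y + cform D Y X" for X Y
    by (simp add: killing_complexification cform_def D(2) complex_eq_iff)
  then have C.solvable
    using C.solvable_if_killing_eq_derivation[OF dual_derivation_complexification[OF D(1)]] by blast
  then obtain n where n: "C.derived_series n = {0}" by (auto simp: C.solvable_def)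
  have "derived_series n \<subseteq> {0}"
    using derived_series_complexification[of _ n] n by (auto simp: zero_prod_def)
  moreover have "0 \<in> derived_series n" by (cases n) (auto simp: span_zero)
  ultimately show ?thesis unfolding solvable_def by blast
qed

end

theorem theorem6p3:
  "(\<forall>(scale :: real \<Rightarrow> 'a::ab_group_add \<Rightarrow> 'a) bracket.
      finite_dim_lie_algebra scale bracket \<longrightarrow>
      lie_algebra.Tstar_solitary scale bracket \<longrightarrow>
      lie_algebra.solvable scale bracket) \<and>
   (\<forall>(scale :: complex \<Rightarrow> 'b::ab_group_add \<Rightarrow> 'b) bracket.
      finite_dim_lie_algebra scale bracket \<longrightarrow>
      lie_algebra.Tstar_solitary scale bracket \<longrightarrow>
      lie_algebra.solvable scale bracket)"
proof (intro conjI allI impI)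
  fix scale :: "real \<Rightarrow> 'a \<Rightarrow> 'a" and bracket
  assume "finite_dim_lie_algebra scale bracket" and sol: "lie_algebra.Tstar_solitary scale bracket"
  then interpret finite_dim_lie_algebra scale bracket by simp
  obtain B where "finite_dimensional_vector_space scale B"
    using finite_dimensional by blast
  then interpret real_fd_lie_algebra scale bracket B
    by (intro real_fd_lie_algebra.intro fd_lie_algebra.intro fd_endo_space.intro endo_space.intro
        lie_algebra_axioms vector_space_axioms)
  show "lie_algebra.solvable scale bracket" by (rule solvable_if_Tstar_solitary[OF sol])
next
  fix scale :: "complex \<Rightarrow> 'b \<Rightarrow> 'b" and bracket
  assume "finite_dim_lie_algebra scale bracket" and sol: "lie_algebra.Tstar_solitary scale bracket"
  then interpret finite_dim_lie_algebra scale bracket by simp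
  obtain B where "finite_dimensional_vector_space scale B"
    using finite_dimensional by blast
  then interpret complex_lie_algebra scale bracket B
    by (intro complex_lie_algebra.intro fd_lie_algebra.intro fd_endo_space.intro endo_space.intro
        complex_endo_space.intro lie_algebra_axioms vector_space_axioms)
  show "lie_algebra.solvable scale bracket"
    using Tstar_solitary_killing[OF sol] solvable_if_killing_eq_derivation by metis
qed

end
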